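(* Let $\nu$ be a nonzero finite positive Borel measure on $[0,1]$, let $c_\nu\in[1,2]$ be its critical index and $c_\nu'$ the dual exponent of $c_\nu$. Let $(p,q)\in[1,\infty]\times[1,\infty]$ be such that $\left(\frac1p,\frac1q\right)\notin\mathcal C$, where $$\mathcal C=\left\{\left(\frac1p,\frac1q\right):\ 1\le p\le c_\nu',\ \frac1q=\frac1p+\frac1{c_\nu}-1\right\}.$$ Then $T_\nu:L^p(\mathbb D)\to L^q(\mathbb D)$ is bounded if and only if $(p,q)$ satisfies one of the following conditions: (a) $p=1$ and $1\le q<c_\nu$; (b) $1<p<c_\nu'$ and $\frac1q>\frac1p+\frac1{c_\nu}-1$; (c) $p=c_\nu'$ and $1\le q<\infty$; (d) $p>c_\nu'$ and $1\le q\le\infty$.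
   Context: $\mathbb D$ is the open unit disk in $\mathbb C$, $dA$ is the Lebesgue area measure normalized so that $A(\mathbb D)=1$, and $L^p(\mathbb D)=L^p(\mathbb D,dA)$. For a finite positive Borel measure $\nu$ on $[0,1]$, the Shimorin-type operator is $$T_\nu f(z)=\int_{\mathbb D}\frac{1}{1-z\overline\lambda}\left(\int_0^1\frac{d\nu(r)}{1-rz\overline\lambda}\right)f(\lambda)\,dA(\lambda),\quad z\in\mathbb D.$$ The critical index is $$c_\nu=\sup\left\{1\le c<2:\ \int_0^1\frac{1}{(1-r^2)^{2/c'}}\,d\nu(r)<\infty\right\},$$ where $c'$ denotes the dual exponent, $1/c+1/c'=1$ (with $1'=\infty$, $1/\infty=0$, so that for $c=1$ the integrand is identically $1$). The integral $\int_0^1$ is over $[0,1]$. *)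

theory Defs
  imports "HOL-Analysis.Analysis" "HOL-Probability.Essential_Supremum"
begin

abbreviation unit_disk :: "complex set"  ("\<D>")
  where "\<D> \<equiv> ball 0 1"

definition disk_area :: "complex measure"
  where "disk_area = uniform_measure (restrict_space lborel \<D>) \<D>"

lemma sets_disk_area: "sets disk_area = sets (restrict_space borel \<D>)"
  unfolding disk_area_def sets_uniform_measure
  by (rule sets_restrict_space_cong) simp

lemma space_disk_area: "space disk_area = \<D>"
  by (simp add: disk_area_def space_restrict_space)

lemma emeasure_disk_area:
  assumes "A \<in> sets borel" "A \<subseteq> \<D>"
  shows "emeasure disk_area A = emeasure lborel A / ennreal pi"
proof -
  have *: "emeasure (restrict_space lborel \<D>) B = emeasure lborel B" if "B \<subseteq> \<D>" for B
    using that by (subst emeasure_restrict_space) auto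
  have sets: "\<D> \<in> sets (restrict_space lborel \<D>)" "A \<in> sets (restrict_space lborel \<D>)"
    using assms by (auto simp: sets_restrict_space_iff)
  have "emeasure lborel \<D> = ennreal pi"
    by (simp add: emeasure_ball unit_ball_vol_2)
  moreover have "\<D> \<inter> A = A"
    using assms(2) by blast
  ultimately show ?thesis
    using sets assms(2) by (simp add: disk_area_def *)
qed

text \<open>
  Exponents live in the extended reals. There \<open>1 / \<infinity> = 0\<close> and \<open>1 / 0 = \<infinity>\<close>, so the
  reciprocal of an exponent in \<open>[1, \<infinity>]\<close>, as well as its dual exponent, has its usual meaning.
\<close>

definition dual_exponent :: "ereal \<Rightarrow> ereal"
  where "dual_exponent c = 1 / (1 - 1 / c)"

lemma dual_exponent:
  assumes "1 \<le> c"
  shows "1 / c + 1 / dual_exponent c = 1" "1 \<le> dual_exponent c"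
proof -
  show "1 / c + 1 / dual_exponent c = 1"
    using assms by (cases c) (auto simp: dual_exponent_def divide_ereal_def one_ereal_def field_simps)
  show "1 \<le> dual_exponent c"
    using assms by (cases c) (auto simp: dual_exponent_def divide_ereal_def one_ereal_def field_simps)
qed

text \<open>
  Elements of \<open>Lp p M\<close> are functions rather than classes modulo almost everywhere equality,
  so \<open>Lp_norm\<close> is a seminorm on them. Both are meant for \<open>1 \<le> p \<le> \<infinity>\<close>.
\<close>

definition Lp :: "ereal \<Rightarrow> 'a measure \<Rightarrow> ('a \<Rightarrow> complex) set"
  where "Lp p M = {f \<in> borel_measurable M.
    if p = \<infinity> then esssup M (\<lambda>x. ereal (norm (f x))) < \<infinity>
    else integrable M (\<lambda>x. norm (f x) powr real_of_ereal p)}"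

definition Lp_norm :: "ereal \<Rightarrow> 'a measure \<Rightarrow> ('a \<Rightarrow> complex) \<Rightarrow> real"
  where "Lp_norm p M f =
    (if p = \<infinity> then real_of_ereal (esssup M (\<lambda>x. ereal (norm (f x))))
     else (\<integral>x. norm (f x) powr real_of_ereal p \<partial>M) powr (1 / real_of_ereal p))"

definition bounded_Lp_Lq ::
  "ereal \<Rightarrow> ereal \<Rightarrow> 'a measure \<Rightarrow> (('a \<Rightarrow> complex) \<Rightarrow> 'a \<Rightarrow> complex) \<Rightarrow> bool"
  where "bounded_Lp_Lq p q M T \<longleftrightarrow>
    (\<exists>C\<ge>0. \<forall>f\<in>Lp p M. T f \<in> Lp q M \<and> Lp_norm q M (T f) \<le> C * Lp_norm p M f)"

definition shimorin_op :: "real measure \<Rightarrow> (complex \<Rightarrow> complex) \<Rightarrow> complex \<Rightarrow> complex"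
  where "shimorin_op \<nu> f z =
    (\<integral>w. 1 / (1 - z * cnj w) * (\<integral>r. 1 / (1 - complex_of_real r * z * cnj w) \<partial>\<nu>) * f w
      \<partial>disk_area)"

text \<open>
  The weight \<open>1 / (1 - r\<^sup>2) powr (2 / c')\<close> with values in \<open>[0, \<infinity>]\<close>. The division is the one of
  \<^typ>\<open>ennreal\<close>, so for \<open>c > 1\<close> the weight is \<open>\<infinity>\<close> at \<open>r = 1\<close>; the case \<open>c = 1\<close> (exponent 0)
  is separate because \<open>0 powr 0 = 0\<close>.
\<close>

definition critical_weight :: "ereal \<Rightarrow> real \<Rightarrow> ennreal"
  where "critical_weight c r =
    (if c = 1 then 1
     else 1 / ennreal ((1 - r\<^sup>2) powr real_of_ereal (2 / dual_exponent c)))"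

definition critical_index :: "real measure \<Rightarrow> ereal"
  where "critical_index \<nu> =
    Sup {c. 1 \<le> c \<and> c < 2 \<and> (\<integral>\<^sup>+ r. critical_weight c r \<partial>\<nu>) < \<infinity>}"

definition critical_segment :: "real measure \<Rightarrow> (ereal \<times> ereal) set"
  where "critical_segment \<nu> =
    {(1 / p, 1 / q) | p q. 1 \<le> p \<and> p \<le> dual_exponent (critical_index \<nu>) \<and> 1 \<le> q \<and>
       1 / q = 1 / p + 1 / critical_index \<nu> - 1}"

end

theory Submission
  imports Defs "HOL-Probability.Probability_Measure"
begin

text \<open>
  Write \<open>1/c\<close> for the reciprocal of the critical index. Read in terms of the reciprocals
  \<open>1/p\<close> and \<open>1/q\<close>, the four alternatives together say exactly that
  \<open>1/q > 1/p + 1/c - 1\<close> (lemma \<open>exponent_conditions_iff\<close>), and the excluded segment is the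
  part of the line \<open>1/q = 1/p + 1/c - 1\<close> on which neither implication is claimed. So two
  statements are needed: the strict inequality implies boundedness, and boundedness implies the
  weak inequality.

  \<^bold>\<open>Sufficiency.\<close> Put \<open>u = z * cnj w\<close>. Since \<open>\<bar>1 - r u\<bar> \<ge> 1 - r\<close> and
  \<open>\<bar>1 - r u\<bar> \<ge> \<bar>1 - u\<bar> / 2\<close>, interpolating between the two bounds shows that the kernel of
  the operator is dominated by a multiple of \<open>\<bar>1 - u\<bar> powr - (2/c1)\<close> whenever the integral
  defining the critical index is finite at \<open>c1\<close> (lemma \<open>norm_kernel_le\<close>). The function
  \<open>w \<mapsto> \<bar>1 - z * cnj w\<bar> powr - s\<close> is integrable over the disk, uniformly in \<open>z\<close>, for
  \<open>s < 2\<close>. If \<open>c > 1\<close>, the kernel is thus uniformly in \<open>L\<^sup>m\<close> in each variable for every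
  \<open>m < c\<close>, and Young's inequality for integral operators (lemmas \<open>bounded_integral_op_Lp_Lq\<close>
  and \<open>bounded_integral_op_Lp_infinity\<close>) gives the claim. If \<open>c = 1\<close>, then \<open>q < p\<close>, the
  kernel is only known to be of Bergman size \<open>\<bar>1 - u\<bar> powr - 2\<close>, and the strict inequality is
  used to move a factor \<open>(1 - \<bar>w\<bar>) powr - \<epsilon>\<close> from the kernel to the function
  (lemma \<open>bounded_integral_op_Bergman\<close>).

  \<^bold>\<open>Necessity.\<close> For \<open>0 < x < 1\<close> apply the operator to the indicator of the disk of radius
  \<open>x/16\<close> about \<open>1 - x\<close>. For \<open>z\<close> and \<open>w\<close> in that disk, \<open>1 - r u\<close> is close to the positive
  number \<open>1 - r (1 - x)\<^sup>2\<close>, so that no cancellation occurs, and boundedness gives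
  \<open>(\<integral>r. 1 / (1 - r (1 - x)\<^sup>2) \<partial>\<nu>) \<le> C x powr (\<beta> - 1)\<close> with \<open>\<beta> = 2/p - 2/q\<close>
  (lemma \<open>integral_shimorin_weight_le\<close>). As the left-hand side is at least the total mass
  of \<open>\<nu>\<close>, which is positive, letting \<open>x\<close> tend to 0 gives \<open>\<beta> \<le> 1\<close>; it also dominates
  \<open>\<nu> {r. 1 - r \<le> x} / (3 x)\<close>, so this tail is \<open>O(x powr \<beta>)\<close>, which makes the integral in the
  definition of the critical index finite below the exponent \<open>\<beta>\<close>. Therefore
  \<open>\<beta> \<le> 2 - 2/c\<close>.

  Both the uniform integrability over the disk and this last step are instances of one dyadic
  estimate: if \<open>M {x. g x \<le> t} \<le> C t powr \<beta>\<close> for \<open>t \<le> 1\<close>, then \<open>g powr - s\<close> has a finite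
  integral for \<open>s < \<beta>\<close> (lemma \<open>nn_integral_inverse_powr_le\<close>).
\<close>

section \<open>Hoelder's inequality and a dyadic estimate\<close>

lemma Holder_integral:
  fixes F G :: "'a \<Rightarrow> real"
  assumes ab: "0 < a" "0 < b" "a + b = 1"
    and F: "integrable M F" "\<And>x. 0 \<le> F x"
    and G: "integrable M G" "\<And>x. 0 \<le> G x"
  shows "integrable M (\<lambda>x. F x powr a * G x powr b)"
    and "(\<integral>x. F x powr a * G x powr b \<partial>M) \<le> (\<integral>x. F x \<partial>M) powr a * (\<integral>x. G x \<partial>M) powr b"
proof -
  have young: "u powr a * v powr b \<le> a * u + b * v" if "0 \<le> u" "0 \<le> v" for u v :: real
    using Youngs_inequality_0[of a b u v] ab that by (cases "u = 0 \<or> v = 0") auto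
  note [measurable] = borel_measurable_integrable[OF F(1)] borel_measurable_integrable[OF G(1)]
  show int: "integrable M (\<lambda>x. F x powr a * G x powr b)"
  proof (rule Bochner_Integration.integrable_bound)
    show "integrable M (\<lambda>x. a * F x + b * G x)"
      using F G by simp
    show "AE x in M. norm (F x powr a * G x powr b) \<le> norm (a * F x + b * G x)"
      using young F(2) G(2) ab by (auto simp: abs_mult)
  qed simp
  define A B where "A = (\<integral>x. F x \<partial>M)" and "B = (\<integral>x. G x \<partial>M)"
  have nn: "0 \<le> A" "0 \<le> B"
    unfolding A_def B_def using F(2) G(2) by simp_all
  have zero: "(\<integral>x. F x powr a * G x powr b \<partial>M) = 0" if "A = 0 \<or> B = 0"
  proof -
    have "(AE x in M. F x = 0) \<or> (AE x in M. G x = 0)"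
      using that integral_nonneg_eq_0_iff_AE[OF F(1)] integral_nonneg_eq_0_iff_AE[OF G(1)] F(2) G(2)
      unfolding A_def B_def by simp
    then have "AE x in M. F x powr a * G x powr b = 0"
      by (auto elim!: eventually_mono)
    then show ?thesis
      by (rule integral_eq_zero_AE)
  qed
  have "(\<integral>x. F x powr a * G x powr b \<partial>M) \<le> A powr a * B powr b"
  proof (cases "A = 0 \<or> B = 0")
    case True
    then show ?thesis using zero by simp
  next
    case False
    with nn have pos: "0 < A" "0 < B" by auto
    have "(\<integral>x. F x powr a * G x powr b \<partial>M)
        \<le> (\<integral>x. A powr a * B powr b * (a * (F x / A) + b * (G x / B)) \<partial>M)"
    proof (rule integral_mono[OF int])
      fix x
      have "(F x / A) powr a * (G x / B) powr b \<le> a * (F x / A) + b * (G x / B)"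
        using F(2)[of x] G(2)[of x] pos by (intro young) simp_all
      then have "A powr a * B powr b * ((F x / A) powr a * (G x / B) powr b)
          \<le> A powr a * B powr b * (a * (F x / A) + b * (G x / B))"
        by (intro mult_left_mono) auto
      then show "F x powr a * G x powr b \<le> A powr a * B powr b * (a * (F x / A) + b * (G x / B))"
        using pos F(2) G(2) by (simp add: powr_divide)
    qed (use F G in auto)
    also have "\<dots> = A powr a * B powr b * (a * (A / A) + b * (B / B))"
      using F G by (simp add: A_def B_def)
    also have "\<dots> = A powr a * B powr b"
      using pos ab by simp
    finally show ?thesis .
  qed
  then show "(\<integral>x. F x powr a * G x powr b \<partial>M) \<le> (\<integral>x. F x \<partial>M) powr a * (\<integral>x. G x \<partial>M) powr b"
    by (simp add: A_def B_def)
qed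

text \<open>
  The value \<open>y = 0\<close> is included: there the left-hand side is \<open>\<infinity>\<close>, and every term of
  the series is at least 1.
\<close>

lemma dyadic_bound:
  fixes y s :: real
  assumes "0 \<le> y" "0 < s"
  shows "1 / ennreal (y powr s) \<le> ennreal (2 powr s) *
    (1 + (\<Sum>n. ennreal (2 powr (real n * s)) * indicator {..2 powr - real n} y))"
proof -
  let ?u = "\<lambda>n. ennreal (2 powr (real n * s)) * indicator {..2 powr - real n} y"
  have two: "1 \<le> 2 powr s" using assms by (simp add: ge_one_powr_ge_zero)
  consider "y = 0" | "1 < y" | "0 < y" "y \<le> 1" using assms by linarith
  then show ?thesis
  proof cases
    case 1
    have "of_nat N \<le> (\<Sum>n. ?u n)" for N
    proof -
      have "of_nat N = (\<Sum>n<N. 1::ennreal)" by simp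
      also have "\<dots> \<le> (\<Sum>n<N. ?u n)"
      proof (rule sum_mono)
        fix n :: nat
        have "1 \<le> 2 powr (real n * s)" using assms by (simp add: ge_one_powr_ge_zero)
        then show "1 \<le> ?u n" using 1 by (simp add: ennreal_ge_1)
      qed
      also have "\<dots> \<le> (\<Sum>n. ?u n)" by (rule sum_le_suminf) auto
      finally show ?thesis .
    qed
    then have "(\<Sum>n. ?u n) = top"
      using ennreal_Ex_less_of_nat by (metis leD top.not_eq_extremum)
    then show ?thesis using two by (simp add: ennreal_mult_top)
  next
    case 2
    have "1 \<le> y powr s" using 2 assms by (simp add: ge_one_powr_ge_zero)
    then have "1 / ennreal (y powr s) \<le> 1"
      by (subst ennreal_1[symmetric], subst divide_ennreal) (auto simp: divide_le_eq)
    also have "\<dots> \<le> ennreal (2 powr s) * 1" using two by (simp add: ennreal_ge_1)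
    also have "\<dots> \<le> ennreal (2 powr s) * (1 + (\<Sum>n. ?u n))"
      by (intro mult_left_mono) auto
    finally show ?thesis .
  next
    case 3
    define n where "n = nat \<lfloor>- log 2 y\<rfloor>"
    have l: "0 \<le> - log 2 y" using 3 by simp
    have n: "real n \<le> - log 2 y" "- log 2 y < real n + 1"
      unfolding n_def using l by linarith+
    have y1: "y \<le> 2 powr - real n"
      using n 3 by (subst powr_log_cancel[of 2 y, symmetric]) (auto simp del: powr_log_cancel)
    have y2: "2 powr (- (real n + 1)) \<le> y"
      using n 3 by (subst powr_log_cancel[of 2 y, symmetric]) (auto simp del: powr_log_cancel)
    have "(2 powr (- (real n + 1))) powr s \<le> y powr s"
      using y2 assms by (intro powr_mono2) auto
    then have "1 / y powr s \<le> 1 / (2 powr (- (real n + 1))) powr s"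
      using 3 by (intro divide_left_mono) auto
    also have "\<dots> = 2 powr s * 2 powr (real n * s)"
      by (simp add: powr_powr powr_minus powr_add[symmetric] field_simps)
    finally have "1 / ennreal (y powr s) \<le> ennreal (2 powr s * 2 powr (real n * s))"
      using 3 by (subst ennreal_1[symmetric], subst divide_ennreal) (auto intro: ennreal_leI)
    also have "\<dots> = ennreal (2 powr s) * (\<Sum>k\<in>{n}. ?u k)"
      using y1 by (simp add: ennreal_mult)
    also have "\<dots> \<le> ennreal (2 powr s) * (\<Sum>k. ?u k)"
      by (intro mult_left_mono sum_le_suminf) auto
    also have "\<dots> \<le> ennreal (2 powr s) * (1 + (\<Sum>k. ?u k))"
      by (intro mult_left_mono) auto
    finally show ?thesis .
  qed
qed

lemma nn_integral_inverse_powr_le: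
  fixes g :: "'a \<Rightarrow> real"
  assumes M: "finite_measure M" and g[measurable]: "g \<in> borel_measurable M"
    and g0: "\<And>x. x \<in> space M \<Longrightarrow> 0 \<le> g x"
    and s: "0 < s" "s < \<beta>" and C: "0 \<le> C"
    and meas: "\<And>t. 0 < t \<Longrightarrow> t \<le> 1 \<Longrightarrow> measure M {x \<in> space M. g x \<le> t} \<le> C * t powr \<beta>"
  shows "(\<integral>\<^sup>+x. 1 / ennreal (g x powr s) \<partial>M)
    \<le> ennreal (2 powr s * (measure M (space M) + C / (1 - 2 powr (s - \<beta>))))"
proof -
  interpret finite_measure M by fact
  define \<rho> where "\<rho> = 2 powr (s - \<beta>)"
  have \<rho>: "0 < \<rho>" "\<rho> < 1" using s powr_less_mono[of "s - \<beta>" 0 2] by (auto simp: \<rho>_def)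
  let ?u = "\<lambda>n x. ennreal (2 powr (real n * s)) * indicator {x \<in> space M. g x \<le> 2 powr - real n} x"
  have tm: "(\<integral>\<^sup>+x. ?u n x \<partial>M) \<le> ennreal (C * \<rho> ^ n)" for n
  proof -
    have "(\<integral>\<^sup>+x. ?u n x \<partial>M)
        = ennreal (2 powr (real n * s)) * emeasure M {x \<in> space M. g x \<le> 2 powr - real n}"
      by (rule nn_integral_cmult_indicator) measurable
    also have "\<dots> = ennreal (2 powr (real n * s) * measure M {x \<in> space M. g x \<le> 2 powr - real n})"
      by (simp add: emeasure_eq_measure ennreal_mult)
    also have "\<dots> \<le> ennreal (2 powr (real n * s) * (C * (2 powr - real n) powr \<beta>))"
    proof (intro ennreal_leI mult_left_mono meas)
      show "2 powr - real n \<le> (1::real)" using powr_mono[of "- real n" 0 2] by simp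
    qed auto
    also have "2 powr (real n * s) * (C * (2 powr - real n) powr \<beta>) = C * \<rho> ^ n"
      by (simp add: \<rho>_def powr_realpow[symmetric] powr_powr powr_add[symmetric] algebra_simps)
    finally show ?thesis .
  qed
  have "(\<integral>\<^sup>+x. 1 / ennreal (g x powr s) \<partial>M)
      \<le> (\<integral>\<^sup>+x. ennreal (2 powr s) * (1 + (\<Sum>n. ?u n x)) \<partial>M)"
  proof (rule nn_integral_mono)
    fix x assume x: "x \<in> space M"
    show "1 / ennreal (g x powr s) \<le> ennreal (2 powr s) * (1 + (\<Sum>n. ?u n x))"
      using dyadic_bound[OF g0[OF x] s(1)] x by (simp add: indicator_def)
  qed
  also have "\<dots> = ennreal (2 powr s) * (emeasure M (space M) + (\<Sum>n. \<integral>\<^sup>+x. ?u n x \<partial>M))"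
    by (simp add: nn_integral_cmult nn_integral_add nn_integral_suminf)
  also have "\<dots> \<le> ennreal (2 powr s) * (ennreal (measure M (space M)) + (\<Sum>n. ennreal (C * \<rho> ^ n)))"
    by (intro mult_left_mono add_mono suminf_le tm) (auto simp: emeasure_eq_measure)
  also have "(\<Sum>n. ennreal (C * \<rho> ^ n)) = ennreal (C / (1 - \<rho>))"
  proof -
    have "(\<lambda>n. C * \<rho> ^ n) sums (C * (1 / (1 - \<rho>)))"
      using \<rho> by (intro sums_mult geometric_sums) auto
    then show ?thesis
      using C \<rho> by (subst suminf_ennreal2) (auto simp: sums_iff)
  qed
  also have "ennreal (2 powr s) * (ennreal (measure M (space M)) + ennreal (C / (1 - \<rho>)))
      = ennreal (2 powr s * (measure M (space M) + C / (1 - \<rho>)))"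
    using C \<rho> by (simp add: ennreal_mult ennreal_plus[symmetric] del: ennreal_plus)
  finally show ?thesis by (simp add: \<rho>_def)
qed

lemma integral_inverse_powr_le:
  fixes g :: "'a \<Rightarrow> real"
  assumes M: "finite_measure M" and g[measurable]: "g \<in> borel_measurable M"
    and g0: "\<And>x. x \<in> space M \<Longrightarrow> 0 < g x"
    and s: "0 < s" "s < \<beta>" and C: "0 \<le> C"
    and meas: "\<And>t. 0 < t \<Longrightarrow> t \<le> 1 \<Longrightarrow> measure M {x \<in> space M. g x \<le> t} \<le> C * t powr \<beta>"
  shows "integrable M (\<lambda>x. g x powr - s)"
    and "(\<integral>x. g x powr - s \<partial>M) \<le> 2 powr s * (measure M (space M) + C / (1 - 2 powr (s - \<beta>)))"
      (is "_ \<le> ?K")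
proof -
  have "2 powr (s - \<beta>) < 1" using s powr_less_mono[of "s - \<beta>" 0 2] by auto
  then have K: "0 \<le> ?K" using C by (intro mult_nonneg_nonneg add_nonneg_nonneg divide_nonneg_nonneg) auto
  have eq: "ennreal (g x powr - s) = 1 / ennreal (g x powr s)" if "x \<in> space M" for x
    using g0[OF that] by (subst ennreal_1[symmetric], subst divide_ennreal) (auto simp: powr_minus_divide)
  have le: "(\<integral>\<^sup>+x. ennreal (g x powr - s) \<partial>M) \<le> ennreal ?K"
    using nn_integral_inverse_powr_le[of M g s \<beta> C] assms
    by (simp add: eq less_imp_le cong: nn_integral_cong)
  show int: "integrable M (\<lambda>x. g x powr - s)"
  proof (rule integrableI_nonneg)
    show "(\<integral>\<^sup>+x. ennreal (g x powr - s) \<partial>M) < \<infinity>"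
      using le by (rule order.strict_trans1) simp
  qed auto
  show "(\<integral>x. g x powr - s \<partial>M) \<le> ?K"
    using le K by (subst (asm) nn_integral_eq_integral[OF int]) auto
qed

section \<open>Lebesgue spaces over a probability space\<close>

lemma Lp_ereal_iff:
  "f \<in> Lp (ereal p) M \<longleftrightarrow> f \<in> borel_measurable M \<and> integrable M (\<lambda>x. norm (f x) powr p)"
  by (simp add: Lp_def)

lemma Lp_norm_ereal:
  "Lp_norm (ereal p) M f = (\<integral>x. norm (f x) powr p \<partial>M) powr (1 / p)"
  by (simp add: Lp_norm_def)

lemma Lp_infinityI:
  assumes "prob_space M" "f \<in> borel_measurable M" "0 \<le> B" "AE x in M. norm (f x) \<le> B"
  shows "f \<in> Lp \<infinity> M" "Lp_norm \<infinity> M f \<le> B"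
proof -
  have "esssup M (\<lambda>x. ereal (norm (f x))) \<le> ereal B"
    using assms by (intro esssup_I) auto
  then show "f \<in> Lp \<infinity> M" "Lp_norm \<infinity> M f \<le> B"
    using assms by (cases "esssup M (\<lambda>x. ereal (norm (f x)))"; auto simp: Lp_def Lp_norm_def)+
qed

lemma Lp_infinityD:
  assumes "prob_space M" "f \<in> Lp \<infinity> M"
  shows "f \<in> borel_measurable M" "0 \<le> Lp_norm \<infinity> M f" "AE x in M. norm (f x) \<le> Lp_norm \<infinity> M f"
proof -
  interpret prob_space M by fact
  let ?e = "esssup M (\<lambda>x. ereal (norm (f x)))"
  show "f \<in> borel_measurable M" using assms(2) by (simp add: Lp_def)
  have AE: "AE x in M. ereal (norm (f x)) \<le> ?e" by (rule esssup_AE)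
  have "0 \<le> ?e"
  proof (rule ccontr)
    assume "\<not> 0 \<le> ?e"
    have "AE x in M. 0 \<le> ?e"
      using AE by eventually_elim (meson ereal_less_eq(5) norm_ge_zero order_trans)
    with \<open>\<not> 0 \<le> ?e\<close> show False by simp
  qed
  moreover have "?e < \<infinity>" using assms(2) by (simp add: Lp_def)
  ultimately obtain B where B: "?e = ereal B" "0 \<le> B" by (cases ?e) auto
  then show "0 \<le> Lp_norm \<infinity> M f" "AE x in M. norm (f x) \<le> Lp_norm \<infinity> M f"
    using AE by (auto simp: Lp_norm_def)
qed

lemma Lp_antimono:
  assumes M: "prob_space M" and p: "1 \<le> p" "p \<le> q" and f: "f \<in> Lp q M"
  shows "f \<in> Lp p M" "Lp_norm p M f \<le> Lp_norm q M f"
proof -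
  interpret prob_space M by fact
  have "f \<in> Lp p M \<and> Lp_norm p M f \<le> Lp_norm q M f"
  proof (cases "p = q")
    case True
    then show ?thesis using f by simp
  next
    case False
    with p have "p < q" by simp
    then have "p \<noteq> \<infinity>" "p \<noteq> - \<infinity>" using p by auto
    then obtain a where a: "p = ereal a" by (cases p) auto
    with p have a1: "1 \<le> a" by (simp add: one_ereal_def)
    have [measurable]: "f \<in> borel_measurable M" using f by (simp add: Lp_def)
    show ?thesis
    proof (cases "q = \<infinity>")
      case True
      note D = Lp_infinityD[OF M f[unfolded True]]
      let ?B = "Lp_norm \<infinity> M f"
      have le: "AE x in M. norm (f x) powr a \<le> ?B powr a"
        using D(3) by eventually_elim (use a1 in \<open>auto intro: powr_mono2\<close>)
      have int: "integrable M (\<lambda>x. norm (f x) powr a)"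
        by (rule integrable_const_bound[where B="?B powr a"]) (use le in auto)
      have "(\<integral>x. norm (f x) powr a \<partial>M) \<le> (\<integral>x. ?B powr a \<partial>M)"
        by (rule integral_mono_AE[OF int _ le]) simp
      then have "(\<integral>x. norm (f x) powr a \<partial>M) powr (1 / a) \<le> (?B powr a) powr (1 / a)"
        using a1 by (intro powr_mono2) (auto simp: prob_space)
      also have "\<dots> = ?B" using a1 D(2) by (simp add: powr_powr)
      finally show ?thesis
        using int by (simp add: a True Lp_ereal_iff Lp_norm_ereal)
    next
      case False
      then obtain b where b: "q = ereal b" using \<open>p < q\<close> a by (cases q) auto
      have ab: "a < b" using \<open>p < q\<close> a b by simp
      have int_b: "integrable M (\<lambda>x. norm (f x) powr b)" using f b by (simp add: Lp_ereal_iff)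
      have frac: "0 < a / b" "0 < 1 - a / b" "a / b + (1 - a / b) = 1"
        using a1 ab by (auto simp: field_simps)
      have eq: "(norm (f x) powr b) powr (a / b) = norm (f x) powr a" for x
        using a1 ab by (simp add: powr_powr)
      note H = Holder_integral[OF frac int_b _ integrable_const[of 1], simplified eq, simplified]
      have "(\<integral>x. norm (f x) powr a \<partial>M) powr (1 / a)
          \<le> ((\<integral>x. norm (f x) powr b \<partial>M) powr (a / b)) powr (1 / a)"
        using a1 H by (intro powr_mono2) (auto simp: prob_space)
      also have "\<dots> = (\<integral>x. norm (f x) powr b \<partial>M) powr (1 / b)"
        using a1 by (simp add: powr_powr)
      finally show ?thesis
        using H by (simp add: a b Lp_ereal_iff Lp_norm_ereal)
    qed
  qed
  then show "f \<in> Lp p M" "Lp_norm p M f \<le> Lp_norm q M f" by auto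
qed

lemma bounded_Lp_Lq_mono:
  assumes M: "prob_space M" and "bounded_Lp_Lq p q M T"
    and "1 \<le> p" "p \<le> p'" "1 \<le> q'" "q' \<le> q"
  shows "bounded_Lp_Lq p' q' M T"
proof -
  obtain C where C: "0 \<le> C" "\<And>f. f \<in> Lp p M \<Longrightarrow> T f \<in> Lp q M"
    "\<And>f. f \<in> Lp p M \<Longrightarrow> Lp_norm q M (T f) \<le> C * Lp_norm p M f"
    using assms(2) by (auto simp: bounded_Lp_Lq_def)
  show ?thesis
    unfolding bounded_Lp_Lq_def
  proof (intro exI[of _ C] conjI ballI C(1))
    fix f assume "f \<in> Lp p' M"
    then have f: "f \<in> Lp p M" "Lp_norm p M f \<le> Lp_norm p' M f"
      using Lp_antimono[OF M \<open>1 \<le> p\<close> \<open>p \<le> p'\<close>] by auto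
    have Tf: "T f \<in> Lp q' M" "Lp_norm q' M (T f) \<le> Lp_norm q M (T f)"
      using Lp_antimono[OF M \<open>1 \<le> q'\<close> \<open>q' \<le> q\<close>] C(2)[OF f(1)] by auto
    show "T f \<in> Lp q' M" by (rule Tf)
    show "Lp_norm q' M (T f) \<le> C * Lp_norm p' M f"
      using Tf(2) C(3)[OF f(1)] mult_left_mono[OF f(2) C(1)] by linarith
  qed
qed

section \<open>The normalized area measure of the disk\<close>

lemma prob_space_disk_area: "prob_space disk_area"
proof
  have "emeasure lborel \<D> = ennreal pi"
    by (simp add: emeasure_ball unit_ball_vol_2)
  then show "emeasure disk_area (space disk_area) = 1"
    by (subst space_disk_area, subst emeasure_disk_area) (auto simp: divide_ennreal)
qed

interpretation disk: prob_space disk_area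
  by (rule prob_space_disk_area)

lemma measurable_ident_disk [measurable]: "(\<lambda>z. z) \<in> borel_measurable disk_area"
  using sets_disk_area measurable_restrict_space1[of "\<lambda>z. z" borel borel \<D>]
  by (simp cong: measurable_cong_sets)

lemma measurable_disk_area:
  assumes "f \<in> borel_measurable borel"
  shows "f \<in> borel_measurable disk_area"
  by (rule measurable_compose[OF measurable_ident_disk assms])

lemma measurable_cnj [measurable]: "cnj \<in> borel_measurable borel"
  by (intro borel_measurable_continuous_onI continuous_intros)

lemma sets_disk_area_iff: "A \<in> sets disk_area \<longleftrightarrow> A \<in> sets borel \<and> A \<subseteq> \<D>"
  by (auto simp: sets_disk_area sets_restrict_space_iff)

lemma measure_disk_area:
  assumes "A \<in> sets borel" "A \<subseteq> \<D>"
  shows "measure disk_area A = measure lborel A / pi"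
proof -
  have "emeasure lborel A \<le> emeasure lborel \<D>"
    using assms by (intro emeasure_mono) auto
  also have "\<dots> < \<infinity>" by (simp add: emeasure_ball)
  finally have "emeasure lborel A = ennreal (measure lborel A)"
    by (intro emeasure_eq_ennreal_measure) auto
  then show ?thesis
    using emeasure_disk_area[OF assms] divide_ennreal[of "measure lborel A" pi]
    by (simp add: measure_def[of disk_area])
qed

lemma measure_disk_area_ball:
  assumes "0 \<le> r" "ball a r \<subseteq> \<D>"
  shows "measure disk_area (ball a r) = r\<^sup>2"
  using assms by (subst measure_disk_area) (auto simp: content_ball unit_ball_vol_2 power2_eq_square)

lemma measure_disk_area_cball_le:
  assumes "0 \<le> r" "A \<in> sets disk_area" "A \<subseteq> cball a r"
  shows "measure disk_area A \<le> r\<^sup>2"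
proof -
  have A: "A \<in> sets borel" "A \<subseteq> \<D>" using assms(2) by (auto simp: sets_disk_area_iff)
  have "measure lborel A \<le> measure lborel (cball a r)"
    using A assms by (intro measure_mono_fmeasurable) (auto intro: fmeasurable_compact)
  also have "\<dots> = pi * r\<^sup>2"
    using assms by (simp add: content_cball unit_ball_vol_2)
  finally show ?thesis
    using A by (simp add: measure_disk_area field_simps)
qed

lemma norm_mult_cnj_less_1:
  assumes "z \<in> \<D>" "w \<in> \<D>"
  shows "norm (z * cnj w) < 1"
  using assms mult_strict_mono'[of "norm z" 1 "norm w" 1] by (simp add: norm_mult)

lemma one_minus_mult_cnj_ge:
  assumes "z \<in> \<D>" "w \<in> \<D>"
  shows "1 - norm w \<le> norm (1 - z * cnj w)"
proof -
  have "norm (z * cnj w) \<le> 1 * norm w"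
    unfolding norm_mult using assms by (intro mult_mono) auto
  then show ?thesis
    using norm_triangle_ineq2[of 1 "z * cnj w"] by simp
qed

lemma one_minus_mult_cnj_pos:
  assumes "z \<in> \<D>" "w \<in> \<D>"
  shows "0 < norm (1 - z * cnj w)"
  using one_minus_mult_cnj_ge[OF assms] assms by (simp del: zero_less_norm_iff)

lemma norm_one_minus_mult_cnj_commute:
  "norm (1 - z * cnj w) = norm (1 - w * cnj z)"
  by (subst complex_mod_cnj[symmetric]) (simp add: mult.commute)

text \<open>
  For \<open>\<bar>z\<bar> \<ge> 1/2\<close> the set is contained in the disk of radius \<open>2 t\<close> about \<open>1 / cnj z\<close>, because
  \<open>\<bar>1 - z * cnj w\<bar> = \<bar>z\<bar> \<bar>1 / cnj z - w\<bar>\<close>; for smaller \<open>\<bar>z\<bar>\<close> it is empty unless \<open>t > 1/2\<close>,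
  and then the bound exceeds the total mass 1.
\<close>

lemma measure_one_minus_mult_cnj_le:
  assumes z: "z \<in> \<D>" and t: "0 < t"
  shows "measure disk_area {w \<in> space disk_area. norm (1 - z * cnj w) \<le> t} \<le> 4 * t powr 2"
    (is "measure _ ?A \<le> _")
proof (cases "norm z < 1 / 2 \<and> t \<le> 1 / 2")
  case True
  have e: "?A = {}"
  proof (rule equals0I)
    fix w assume "w \<in> ?A"
    then have w: "w \<in> \<D>" "norm (1 - z * cnj w) \<le> 1 / 2" using True by (auto simp: space_disk_area)
    then show False
      using one_minus_mult_cnj_ge[OF w(1) z] True
      by (subst (asm) norm_one_minus_mult_cnj_commute) linarith
  qed
  then show ?thesis by (simp only: e) simp
next
  case False
  have t2: "4 * t powr 2 = (2 * t)\<^sup>2" using t by (simp add: power2_eq_square)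
  show ?thesis
  proof (cases "t \<le> 1 / 2")
    case True
    with False have nz: "1 / 2 \<le> norm z" by simp
    then have z0: "z \<noteq> 0" by auto
    have "?A \<subseteq> cball (1 / cnj z) (2 * t)"
    proof
      fix w assume "w \<in> ?A"
      then have "norm (1 - w * cnj z) \<le> t" by (subst norm_one_minus_mult_cnj_commute) simp
      moreover have "norm (1 - w * cnj z) = norm z * norm (1 / cnj z - w)"
      proof -
        have "1 - w * cnj z = cnj z * (1 / cnj z - w)" using z0 by (simp add: field_simps)
        then show ?thesis by (metis norm_mult complex_mod_cnj)
      qed
      moreover have "1 / 2 * norm (1 / cnj z - w) \<le> norm z * norm (1 / cnj z - w)"
        using nz by (intro mult_right_mono) auto
      ultimately show "w \<in> cball (1 / cnj z) (2 * t)" by (simp add: dist_norm)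
    qed
    then show ?thesis
      unfolding t2 using t by (intro measure_disk_area_cball_le) auto
  next
    case False
    then have "1\<^sup>2 \<le> (2 * t)\<^sup>2" by (intro power_mono) auto
    then show ?thesis unfolding t2 by (intro order_trans[OF disk.prob_le_1]) simp
  qed
qed

lemma integral_one_minus_mult_cnj_powr:
  assumes s: "0 < s" "s < 2"
  obtains K where "0 < K"
    "\<And>z. z \<in> \<D> \<Longrightarrow> integrable disk_area (\<lambda>w. norm (1 - z * cnj w) powr - s)"
    "\<And>z. z \<in> \<D> \<Longrightarrow> (\<integral>w. norm (1 - z * cnj w) powr - s \<partial>disk_area) \<le> K"
proof -
  let ?K = "2 powr s * (measure disk_area (space disk_area) + 4 / (1 - 2 powr (s - 2)))"
  have "2 powr (s - 2) < 1" using s powr_less_mono[of "s - 2" 0 2] by auto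
  then have K: "0 < ?K" by (intro mult_pos_pos add_pos_pos divide_pos_pos) (auto simp: disk.prob_space)
  have "integrable disk_area (\<lambda>w. norm (1 - z * cnj w) powr - s)
     \<and> (\<integral>w. norm (1 - z * cnj w) powr - s \<partial>disk_area) \<le> ?K" if z: "z \<in> \<D>" for z
  proof -
    have m: "(\<lambda>w. norm (1 - z * cnj w)) \<in> borel_measurable disk_area"
      by (intro measurable_disk_area borel_measurable_continuous_onI continuous_intros)
    have pos: "0 < norm (1 - z * cnj w)" if "w \<in> space disk_area" for w
      using one_minus_mult_cnj_pos[OF z] that by (simp add: space_disk_area)
    show ?thesis
      using integral_inverse_powr_le[OF disk.finite_measure_axioms m pos s, of 4]
        measure_one_minus_mult_cnj_le[OF z] by auto
  qed
  then show ?thesis using K that by blast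
qed

lemma integrable_one_minus_norm_powr:
  assumes s: "0 < s" "s < 1"
  shows "integrable disk_area (\<lambda>w. (1 - norm w) powr - s)"
proof (rule integral_inverse_powr_le)
  show "finite_measure disk_area" by (rule disk.finite_measure_axioms)
  show "(\<lambda>w. 1 - norm w) \<in> borel_measurable disk_area" by measurable
  show "measure disk_area {w \<in> space disk_area. 1 - norm w \<le> t} \<le> 2 * t powr 1"
    if t: "0 < t" "t \<le> 1" for t
  proof -
    have b: "ball 0 (1 - t) \<subseteq> \<D>" "ball 0 (1 - t) \<in> sets disk_area"
      using t by (auto simp: sets_disk_area_iff)
    have "{w \<in> space disk_area. 1 - norm w \<le> t} = space disk_area - ball 0 (1 - t)"
      by (auto simp: space_disk_area)
    also have "measure disk_area \<dots> = 1 - (1 - t)\<^sup>2"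
      using t b by (subst disk.prob_compl) (auto simp: measure_disk_area_ball)
    also have "\<dots> \<le> 2 * t" by (simp add: power2_eq_square algebra_simps)
    finally show ?thesis using t by simp
  qed
qed (use s in \<open>auto simp: space_disk_area\<close>)

section \<open>Integral operators on the disk\<close>

interpretation disk2: pair_sigma_finite disk_area disk_area ..

lemma measurable_fst_disk [measurable]: "fst \<in> borel_measurable (disk_area \<Otimes>\<^sub>M disk_area)"
  by (rule measurable_compose[OF measurable_fst measurable_ident_disk])

lemma measurable_snd_disk [measurable]: "snd \<in> borel_measurable (disk_area \<Otimes>\<^sub>M disk_area)"
  by (rule measurable_compose[OF measurable_snd measurable_ident_disk])

text \<open>
  The operator with kernel \<open>K\<close>. Where \<open>K z w * f w\<close> is not integrable in \<open>w\<close>, the Bochner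
  integral has the default value 0; the upper bounds below are unaffected by this.
\<close>

definition integral_op :: "(complex \<Rightarrow> complex \<Rightarrow> complex) \<Rightarrow> (complex \<Rightarrow> complex) \<Rightarrow> complex \<Rightarrow> complex"
  where "integral_op K f z = (\<integral>w. K z w * f w \<partial>disk_area)"

lemma measurable_integral_op:
  assumes [measurable]: "(\<lambda>(z, w). K z w) \<in> borel_measurable (disk_area \<Otimes>\<^sub>M disk_area)"
    and [measurable]: "f \<in> borel_measurable disk_area"
  shows "integral_op K f \<in> borel_measurable disk_area"
  unfolding integral_op_def [abs_def] by measurable

lemma norm_integral_op_le:
  assumes K: "\<And>w. w \<in> \<D> \<Longrightarrow> norm (K z w) \<le> C * norm (1 - z * cnj w) powr - s"
    and C: "0 \<le> C"
    and int: "integrable disk_area (\<lambda>w. norm (1 - z * cnj w) powr - s * norm (f w))"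
  shows "norm (integral_op K f z) \<le> C * (\<integral>w. norm (1 - z * cnj w) powr - s * norm (f w) \<partial>disk_area)"
proof -
  have "norm (integral_op K f z) \<le> (\<integral>w. norm (K z w * f w) \<partial>disk_area)"
    unfolding integral_op_def by (rule integral_norm_bound)
  also have "\<dots> \<le> (\<integral>w. C * (norm (1 - z * cnj w) powr - s * norm (f w)) \<partial>disk_area)"
  proof (rule integral_mono')
    show "norm (K z w * f w) \<le> C * (norm (1 - z * cnj w) powr - s * norm (f w))"
      if "w \<in> space disk_area" for w
      using mult_right_mono[OF K norm_ge_zero, of w "f w"] that
      by (simp add: norm_mult space_disk_area mult.assoc)
  qed (use int C in auto)
  finally show ?thesis by simp
qed

lemma bounded_integral_op_Lp_infinity:
  assumes K: "(\<lambda>(z, w). K z w) \<in> borel_measurable (disk_area \<Otimes>\<^sub>M disk_area)"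
    and K_le: "\<And>z w. z \<in> \<D> \<Longrightarrow> w \<in> \<D> \<Longrightarrow> norm (K z w) \<le> C * norm (1 - z * cnj w) powr - s"
    and C: "0 \<le> C" and s: "0 < s" and p: "1 < p" and sp: "s / (1 - 1 / p) < 2"
  shows "bounded_Lp_Lq (ereal p) \<infinity> disk_area (integral_op K)"
proof -
  define \<theta> where "\<theta> = 1 - 1 / p"
  have \<theta>: "0 < \<theta>" "\<theta> + 1 / p = 1" using p by (auto simp: \<theta>_def)
  obtain M where M: "0 < M"
    "\<And>z. z \<in> \<D> \<Longrightarrow> integrable disk_area (\<lambda>w. norm (1 - z * cnj w) powr - (s / \<theta>))"
    "\<And>z. z \<in> \<D> \<Longrightarrow> (\<integral>w. norm (1 - z * cnj w) powr - (s / \<theta>) \<partial>disk_area) \<le> M"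
    using integral_one_minus_mult_cnj_powr[of "s / \<theta>"] s sp \<theta> by (auto simp: \<theta>_def)
  show ?thesis
    unfolding bounded_Lp_Lq_def
  proof (intro exI[of _ "C * M powr \<theta>"] conjI ballI)
    fix f assume f: "f \<in> Lp (ereal p) disk_area"
    then have [measurable]: "f \<in> borel_measurable disk_area"
      and fi: "integrable disk_area (\<lambda>w. norm (f w) powr p)" by (auto simp: Lp_ereal_iff)
    have le: "norm (integral_op K f z) \<le> C * M powr \<theta> * Lp_norm (ereal p) disk_area f"
      if z: "z \<in> \<D>" for z
    proof -
      let ?d = "\<lambda>w. norm (1 - z * cnj w)"
      have eq: "(?d w powr - (s / \<theta>)) powr \<theta> * (norm (f w) powr p) powr (1 / p)
          = ?d w powr - s * norm (f w)" for w
        using \<theta> p by (simp add: powr_powr)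
      note H = Holder_integral[of \<theta> "1 / p", OF _ _ _ M(2)[OF z] _ fi, unfolded eq]
      have "norm (integral_op K f z) \<le> C * (\<integral>w. ?d w powr - s * norm (f w) \<partial>disk_area)"
        using \<theta> p K_le[OF z] C by (intro norm_integral_op_le H) auto
      also have "\<dots> \<le> C * ((\<integral>w. ?d w powr - (s / \<theta>) \<partial>disk_area) powr \<theta> * Lp_norm (ereal p) disk_area f)"
        unfolding Lp_norm_ereal using \<theta> p C by (intro mult_left_mono H) auto
      also have "\<dots> \<le> C * (M powr \<theta> * Lp_norm (ereal p) disk_area f)"
        using \<theta> p C M(3)[OF z] by (intro mult_left_mono mult_right_mono powr_mono2) (auto simp: Lp_norm_ereal)
      finally show ?thesis by (simp add: mult.assoc)
    qed
    have "AE z in disk_area. norm (integral_op K f z) \<le> C * M powr \<theta> * Lp_norm (ereal p) disk_area f"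
      using le by (intro AE_I2) (simp only: space_disk_area)
    note B = Lp_infinityI[OF prob_space_disk_area measurable_integral_op[OF K] _ this]
    show "integral_op K f \<in> Lp \<infinity> disk_area"
      using C by (intro B) (auto simp: Lp_norm_ereal)
    show "Lp_norm \<infinity> disk_area (integral_op K f) \<le> C * M powr \<theta> * Lp_norm (ereal p) disk_area f"
      using C by (intro B) (auto simp: Lp_norm_ereal)
  qed (use C in auto)
qed

text \<open>
  Tonelli's theorem for \<open>\<bar>1 - z * cnj w\<bar> powr - s * g w\<close>: the kernel is symmetric, so the bound
  \<open>M\<close> on its integrals over \<open>w\<close> also bounds those over \<open>z\<close>.
\<close>

lemma integral_powr_kernel_mult:
  assumes s: "0 < s"
    and M: "0 < M" "\<And>z. z \<in> \<D> \<Longrightarrow> integrable disk_area (\<lambda>w. norm (1 - z * cnj w) powr - s)"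
      "\<And>z. z \<in> \<D> \<Longrightarrow> (\<integral>w. norm (1 - z * cnj w) powr - s \<partial>disk_area) \<le> M"
    and g: "integrable disk_area g" "\<And>w. 0 \<le> g w"
  shows "\<And>z. z \<in> \<D> \<Longrightarrow> integrable disk_area (\<lambda>w. norm (1 - z * cnj w) powr - s * g w)"
    and "integrable disk_area (\<lambda>z. \<integral>w. norm (1 - z * cnj w) powr - s * g w \<partial>disk_area)"
    and "(\<integral>z. \<integral>w. norm (1 - z * cnj w) powr - s * g w \<partial>disk_area \<partial>disk_area)
      \<le> M * (\<integral>w. g w \<partial>disk_area)"
proof -
  have [measurable]: "g \<in> borel_measurable disk_area" using g(1) by simp
  show int1: "integrable disk_area (\<lambda>w. norm (1 - z * cnj w) powr - s * g w)" if z: "z \<in> \<D>" for z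
  proof (rule Bochner_Integration.integrable_bound)
    show "integrable disk_area (\<lambda>w. (1 - norm z) powr - s * g w)" using g by simp
    show "AE w in disk_area. norm (norm (1 - z * cnj w) powr - s * g w) \<le> norm ((1 - norm z) powr - s * g w)"
    proof (rule AE_I2)
      fix w assume "w \<in> space disk_area"
      then have w: "w \<in> \<D>" by (simp add: space_disk_area)
      have "norm (1 - z * cnj w) powr - s \<le> (1 - norm z) powr - s"
        using one_minus_mult_cnj_ge[OF w z] norm_one_minus_mult_cnj_commute[of z w] z s
        by (intro powr_mono2') auto
      then show "norm (norm (1 - z * cnj w) powr - s * g w) \<le> norm ((1 - norm z) powr - s * g w)"
        using g(2)[of w] by (simp add: abs_mult mult_right_mono)
    qed
  qed simp
  let ?G = "\<lambda>(z, w). norm (1 - z * cnj w) powr - s * g w"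
  have col: "integrable disk_area (\<lambda>z. norm (1 - z * cnj w) powr - s)"
    "(\<integral>z. norm (1 - z * cnj w) powr - s \<partial>disk_area) \<le> M" if "w \<in> \<D>" for w
    using M(2,3)[OF that] norm_one_minus_mult_cnj_commute[of _ w] by simp_all
  have "(\<integral>\<^sup>+x. ennreal (?G x) \<partial>(disk_area \<Otimes>\<^sub>M disk_area))
      = (\<integral>\<^sup>+w. \<integral>\<^sup>+z. ennreal (?G (z, w)) \<partial>disk_area \<partial>disk_area)"
    by (rule disk2.nn_integral_snd[symmetric]) measurable
  also have "\<dots> \<le> (\<integral>\<^sup>+w. ennreal (M * g w) \<partial>disk_area)"
  proof (rule nn_integral_mono)
    fix w assume "w \<in> space disk_area"
    then have w: "w \<in> \<D>" by (simp add: space_disk_area)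
    have "(\<integral>\<^sup>+z. ennreal (?G (z, w)) \<partial>disk_area)
        = ennreal (\<integral>z. norm (1 - z * cnj w) powr - s * g w \<partial>disk_area)"
      using col(1)[OF w] g(2) by (simp add: nn_integral_eq_integral)
    also have "\<dots> \<le> ennreal (M * g w)"
      using col(2)[OF w] g(2)[of w] by (simp add: ennreal_leI mult_right_mono)
    finally show "(\<integral>\<^sup>+z. ennreal (?G (z, w)) \<partial>disk_area) \<le> ennreal (M * g w)" .
  qed
  also have "\<dots> = ennreal (M * (\<integral>w. g w \<partial>disk_area))"
    using g M(1) by (subst nn_integral_eq_integral) auto
  finally have le: "(\<integral>\<^sup>+x. ennreal (?G x) \<partial>(disk_area \<Otimes>\<^sub>M disk_area)) \<le> ennreal (M * (\<integral>w. g w \<partial>disk_area))" .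
  have G: "integrable (disk_area \<Otimes>\<^sub>M disk_area) ?G"
  proof (rule integrableI_nonneg)
    show "(\<integral>\<^sup>+x. ennreal (?G x) \<partial>(disk_area \<Otimes>\<^sub>M disk_area)) < \<infinity>"
      using le by (rule order.strict_trans1) simp
  qed (use g(2) in auto)
  show "integrable disk_area (\<lambda>z. \<integral>w. norm (1 - z * cnj w) powr - s * g w \<partial>disk_area)"
    using disk2.integrable_fst'[OF G] by simp
  have "(\<integral>z. \<integral>w. norm (1 - z * cnj w) powr - s * g w \<partial>disk_area \<partial>disk_area)
      = integral\<^sup>L (disk_area \<Otimes>\<^sub>M disk_area) ?G"
    using disk2.integral_fst'[OF G] by simp
  also have "\<dots> \<le> M * (\<integral>w. g w \<partial>disk_area)"
    using le g M(1) by (subst (asm) nn_integral_eq_integral[OF G]) auto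
  finally show "(\<integral>z. \<integral>w. norm (1 - z * cnj w) powr - s * g w \<partial>disk_area \<partial>disk_area)
      \<le> M * (\<integral>w. g w \<partial>disk_area)" .
qed

text \<open>
  Young's inequality for integral operators, with \<open>1/q = 1/p + 1/m - 1\<close>. With \<open>d = \<bar>1 - z * cnj w\<bar>\<close>,
  the integrand is split as
  \<open>d powr - s * \<bar>f\<bar> = (d powr - (s m) * \<bar>f\<bar> powr p) powr (1/q) * H powr (1 - 1/q)\<close>, where
  \<open>H = (d powr - (s m)) powr \<theta> * (\<bar>f\<bar> powr p) powr (1 - \<theta>)\<close> and \<open>\<theta> (1 - 1/q) = 1 - 1/p\<close>.
  Hoelder's inequality, applied to \<open>H\<close> and then to this product, bounds the \<open>q\<close>-th power of the
  image at \<open>z\<close> by a constant times \<open>A z\<close>, the integral over \<open>w\<close> of the first bracket, which is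
  integrated over \<open>z\<close> by Tonelli's theorem.
\<close>

lemma bounded_integral_op_Lp_Lq:
  assumes K: "(\<lambda>(z, w). K z w) \<in> borel_measurable (disk_area \<Otimes>\<^sub>M disk_area)"
    and K_le: "\<And>z w. z \<in> \<D> \<Longrightarrow> w \<in> \<D> \<Longrightarrow> norm (K z w) \<le> C * norm (1 - z * cnj w) powr - s"
    and C: "0 \<le> C" and s: "0 < s" and pq: "1 \<le> p" "p < q"
    and m: "m * (1 / q - 1 / p + 1) = 1" and sm: "s * m < 2"
  shows "bounded_Lp_Lq (ereal p) (ereal q) disk_area (integral_op K)"
proof -
  have frac: "0 < 1 / q" "1 / q < 1 / p" "1 / p \<le> 1" "1 / q < 1"
    using pq by (auto simp: field_simps)
  then have "0 < 1 / q - 1 / p + 1" by linarith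
  then have m0: "0 < m" using m by (metis zero_less_mult_pos2 zero_less_one)
  define \<theta> where "\<theta> = (1 - 1 / p) / (1 - 1 / q)"
  have \<theta>: "0 \<le> \<theta>" "\<theta> < 1" "\<theta> * (1 - 1 / q) = 1 - 1 / p" "\<theta> = 0 \<longleftrightarrow> p = 1"
    using frac by (auto simp: \<theta>_def)
  obtain M where M: "0 < M"
    "\<And>z. z \<in> \<D> \<Longrightarrow> integrable disk_area (\<lambda>w. norm (1 - z * cnj w) powr - (s * m))"
    "\<And>z. z \<in> \<D> \<Longrightarrow> (\<integral>w. norm (1 - z * cnj w) powr - (s * m) \<partial>disk_area) \<le> M"
    using integral_one_minus_mult_cnj_powr[of "s * m"] s sm m0 by auto
  show ?thesis
    unfolding bounded_Lp_Lq_def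
  proof (intro exI[of _ "C * M powr (1 / q + \<theta> * (1 - 1 / q))"] conjI ballI)
    fix f assume f: "f \<in> Lp (ereal p) disk_area"
    then have [measurable]: "f \<in> borel_measurable disk_area"
      and fi: "integrable disk_area (\<lambda>w. norm (f w) powr p)" by (auto simp: Lp_ereal_iff)
    define N where "N = (\<integral>w. norm (f w) powr p \<partial>disk_area)"
    have N: "0 \<le> N" by (simp add: N_def)
    define A where "A z = (\<integral>w. norm (1 - z * cnj w) powr - (s * m) * norm (f w) powr p \<partial>disk_area)" for z
    have A: "\<And>z. z \<in> \<D> \<Longrightarrow> integrable disk_area (\<lambda>w. norm (1 - z * cnj w) powr - (s * m) * norm (f w) powr p)"
      "integrable disk_area A" "(\<integral>z. A z \<partial>disk_area) \<le> M * N"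
      using integral_powr_kernel_mult[of "s * m" M "\<lambda>w. norm (f w) powr p"] s m0 M fi
      unfolding A_def [abs_def] N_def by auto
    have A0: "0 \<le> A z" for z by (simp add: A_def)
    define B where "B = M powr \<theta> * N powr (1 - \<theta>)"
    have B: "0 \<le> B" by (simp add: B_def)
    have le: "norm (integral_op K f z) \<le> C * (A z powr (1 / q) * B powr (1 - 1 / q))"
      if z: "z \<in> \<D>" for z
    proof -
      let ?d = "\<lambda>w. norm (1 - z * cnj w)"
      let ?H = "\<lambda>w. (?d w powr - (s * m)) powr \<theta> * (norm (f w) powr p) powr (1 - \<theta>)"
      have H: "integrable disk_area ?H \<and> (\<integral>w. ?H w \<partial>disk_area) \<le> B"
      proof (cases "p = 1")
        case True
        then have "\<theta> = 0" using \<theta> by simp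
        have eq: "?H w = norm (f w) powr p" if "w \<in> space disk_area" for w
          using one_minus_mult_cnj_pos[OF z] that \<open>\<theta> = 0\<close> by (simp add: space_disk_area)
        show ?thesis
          using fi M(1) N Bochner_Integration.integrable_cong[OF refl eq, of disk_area]
            Bochner_Integration.integral_cong[OF refl eq, of disk_area]
          by (simp only: B_def) (simp add: \<open>\<theta> = 0\<close> N_def)
      next
        case False
        then have \<theta>0: "0 < \<theta>" using \<theta> by auto
        note H = Holder_integral[of \<theta> "1 - \<theta>", OF _ _ _ M(2)[OF z] _ fi, folded N_def]
        have "(\<integral>w. ?H w \<partial>disk_area) \<le> (\<integral>w. ?d w powr - (s * m) \<partial>disk_area) powr \<theta> * N powr (1 - \<theta>)"
          using \<theta>0 \<theta> by (intro H) auto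
        also have "\<dots> \<le> B"
          unfolding B_def using M(3)[OF z] \<theta> by (intro mult_right_mono powr_mono2) auto
        finally show ?thesis using H(1) \<theta>0 \<theta> by auto
      qed
      have eq: "(?d w powr - (s * m) * norm (f w) powr p) powr (1 / q) * ?H w powr (1 - 1 / q)
          = ?d w powr - s * norm (f w)" for w
      proof -
        have e1: "m / q + m * (\<theta> * (1 - 1 / q)) = 1"
          unfolding \<theta>(3) using m by (simp add: algebra_simps)
        have e2: "p / q + p * ((1 - \<theta>) * (1 - 1 / q)) = 1"
        proof -
          have "(1 - \<theta>) * (1 - 1 / q) = 1 / p - 1 / q" using \<theta>(3) by (simp add: algebra_simps diff_divide_distrib)
          then have "p / q + p * ((1 - \<theta>) * (1 - 1 / q)) = p / q + p * (1 / p - 1 / q)" by (simp only:)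
          then show ?thesis using pq by (simp add: right_diff_distrib)
        qed
        have "(?d w powr - (s * m) * norm (f w) powr p) powr (1 / q) * ?H w powr (1 - 1 / q)
          = (?d w powr (- (s * m) * (1 / q)) * ?d w powr (- (s * m) * \<theta> * (1 - 1 / q)))
            * (norm (f w) powr (p * (1 / q)) * norm (f w) powr (p * (1 - \<theta>) * (1 - 1 / q)))"
          by (simp only: powr_mult powr_powr mult_ac)
        also have "\<dots> = ?d w powr (- (s * m) * (1 / q) + - (s * m) * \<theta> * (1 - 1 / q))
            * norm (f w) powr (p * (1 / q) + p * (1 - \<theta>) * (1 - 1 / q))"
          by (simp only: powr_add)
        also have "- (s * m) * (1 / q) + - (s * m) * \<theta> * (1 - 1 / q)
            = - s * (m / q + m * (\<theta> * (1 - 1 / q)))"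
          by (simp add: algebra_simps)
        also have "p * (1 / q) + p * (1 - \<theta>) * (1 - 1 / q) = p / q + p * ((1 - \<theta>) * (1 - 1 / q))"
          by simp
        finally show ?thesis unfolding e1 e2 by simp
      qed
      note Y = Holder_integral[of "1 / q" "1 - 1 / q", OF _ _ _ A(1)[OF z] _ H[THEN conjunct1], unfolded eq]
      have "norm (integral_op K f z) \<le> C * (\<integral>w. ?d w powr - s * norm (f w) \<partial>disk_area)"
        using K_le[OF z] C frac by (intro norm_integral_op_le Y) auto
      also have "\<dots> \<le> C * (A z powr (1 / q) * (\<integral>w. ?H w \<partial>disk_area) powr (1 - 1 / q))"
        unfolding A_def using C frac by (intro mult_left_mono Y) auto
      also have "\<dots> \<le> C * (A z powr (1 / q) * B powr (1 - 1 / q))"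
        using C frac H by (intro mult_left_mono powr_mono2) auto
      finally show ?thesis .
    qed
    have leq: "norm (integral_op K f z) powr q \<le> C powr q * B powr (q - 1) * A z" if z: "z \<in> \<D>" for z
    proof -
      have "norm (integral_op K f z) powr q \<le> (C * (A z powr (1 / q) * B powr (1 - 1 / q))) powr q"
        using le[OF z] pq by (intro powr_mono2) auto
      also have "\<dots> = C powr q * B powr (q - 1) * A z"
        using C B A0[of z] pq by (simp add: powr_mult powr_powr algebra_simps)
      finally show ?thesis .
    qed
    note [measurable] = measurable_integral_op[OF K \<open>f \<in> borel_measurable disk_area\<close>]
    have int: "integrable disk_area (\<lambda>z. norm (integral_op K f z) powr q)"
    proof (rule Bochner_Integration.integrable_bound)
      show "integrable disk_area (\<lambda>z. C powr q * B powr (q - 1) * A z)" using A(2) by simp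
      show "AE z in disk_area. norm (norm (integral_op K f z) powr q) \<le> norm (C powr q * B powr (q - 1) * A z)"
        using leq A0 by (auto intro!: AE_I2 simp: space_disk_area abs_mult)
    qed simp
    then show "integral_op K f \<in> Lp (ereal q) disk_area" by (simp add: Lp_ereal_iff)
    have "(\<integral>z. norm (integral_op K f z) powr q \<partial>disk_area) \<le> (\<integral>z. C powr q * B powr (q - 1) * A z \<partial>disk_area)"
      using int A(2) leq by (intro integral_mono) (auto simp: space_disk_area)
    also have "\<dots> \<le> C powr q * B powr (q - 1) * (M * N)"
      using A(3) by (simp add: mult_left_mono)
    finally have "Lp_norm (ereal q) disk_area (integral_op K f) \<le> (C powr q * B powr (q - 1) * (M * N)) powr (1 / q)"
      unfolding Lp_norm_ereal using frac by (intro powr_mono2) auto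
    also have "\<dots> = C * (B powr (1 - 1 / q) * (M powr (1 / q) * N powr (1 / q)))"
      using C M(1) N B pq by (simp add: powr_mult powr_powr field_simps)
    also have "B powr (1 - 1 / q) = M powr (\<theta> * (1 - 1 / q)) * N powr (1 / p - 1 / q)"
    proof -
      have "(1 - \<theta>) * (1 - 1 / q) = 1 / p - 1 / q" using \<theta>(3) by (simp add: algebra_simps diff_divide_distrib)
      then show ?thesis
        using M(1) N by (simp add: B_def powr_mult powr_powr)
    qed
    also have "C * (M powr (\<theta> * (1 - 1 / q)) * N powr (1 / p - 1 / q) * (M powr (1 / q) * N powr (1 / q)))
        = C * (M powr (1 / q + \<theta> * (1 - 1 / q)) * N powr (1 / p))"
      by (simp only: powr_add powr_diff) (simp add: powr_add[symmetric] mult_ac)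
    finally show "Lp_norm (ereal q) disk_area (integral_op K f)
        \<le> C * M powr (1 / q + \<theta> * (1 - 1 / q)) * Lp_norm (ereal p) disk_area f"
      by (simp add: Lp_norm_ereal N_def mult.assoc)
  qed (use C in auto)
qed

text \<open>
  A kernel of Bergman size maps \<open>L\<^sup>p\<close> boundedly into \<open>L\<^sup>q\<close> for every \<open>q < p\<close>. Since
  \<open>\<bar>1 - z * cnj w\<bar> \<ge> 1 - \<bar>w\<bar>\<close>, multiplying the kernel by \<open>(1 - \<bar>w\<bar>) powr \<epsilon>\<close> lowers its order to
  \<open>2 - \<epsilon>\<close>, so that it acts boundedly on \<open>L\<^sup>q\<close>, while multiplication by
  \<open>(1 - \<bar>w\<bar>) powr - \<epsilon>\<close> maps \<open>L\<^sup>p\<close> into \<open>L\<^sup>q\<close> by Hoelder's inequality if \<open>\<epsilon>\<close> is small.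
\<close>

lemma bounded_integral_op_Bergman:
  assumes K: "(\<lambda>(z, w). K z w) \<in> borel_measurable (disk_area \<Otimes>\<^sub>M disk_area)"
    and K_le: "\<And>z w. z \<in> \<D> \<Longrightarrow> w \<in> \<D> \<Longrightarrow> norm (K z w) \<le> C * norm (1 - z * cnj w) powr - 2"
    and C: "0 \<le> C" and pq: "1 \<le> q" "q < p"
  shows "bounded_Lp_Lq (ereal p) (ereal q) disk_area (integral_op K)"
proof -
  note [measurable] = K
  \<comment> \<open>This choice turns the Hoelder factor below into the integrable \<open>(1 - \<bar>w\<bar>) powr - (1/2)\<close>.\<close>
  define \<epsilon> where "\<epsilon> = (1 - q / p) / (2 * q)"
  have frac: "0 < q / p" "0 < 1 - q / p" "1 - q / p < 1" using pq by (auto simp: field_simps)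
  have \<epsilon>: "0 < \<epsilon>" "\<epsilon> < 1 / q" "\<epsilon> < 1" "\<epsilon> * q = (1 - q / p) / 2"
  proof -
    show "0 < \<epsilon>" "\<epsilon> * q = (1 - q / p) / 2" using frac pq by (auto simp: \<epsilon>_def)
    then have "\<epsilon> * q < 1" using frac by simp
    then show "\<epsilon> < 1 / q" using pq by (simp add: field_simps)
    also have "1 / q \<le> 1" using pq by simp
    finally show "\<epsilon> < 1" .
  qed
  define K' where "K' z w = K z w * of_real ((1 - norm w) powr \<epsilon>)" for z w
  have K'_le: "norm (K' z w) \<le> C * norm (1 - z * cnj w) powr - (2 - \<epsilon>)" if "z \<in> \<D>" "w \<in> \<D>" for z w
  proof -
    have "norm (K' z w) \<le> (C * norm (1 - z * cnj w) powr - 2) * norm (1 - z * cnj w) powr \<epsilon>"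
      unfolding K'_def norm_mult
      using one_minus_mult_cnj_ge[OF that] \<epsilon> that C
      by (intro mult_mono K_le) (auto intro!: powr_mono2)
    also have "\<dots> = C * norm (1 - z * cnj w) powr - (2 - \<epsilon>)"
      by (simp add: mult.assoc powr_add[symmetric])
    finally show ?thesis .
  qed
  have K'm: "(\<lambda>(z, w). K' z w) \<in> borel_measurable (disk_area \<Otimes>\<^sub>M disk_area)"
    unfolding K'_def case_prod_beta by (use K in \<open>simp add: case_prod_beta\<close>)
  \<comment> \<open>Young's inequality is available into spaces with a larger exponent; any \<open>q2\<close> slightly above \<open>q\<close> will do.\<close>
  define q2 where "q2 = 1 / (1 / q - \<epsilon> / 4)"
  have q2: "q < q2" "1 / q2 = 1 / q - \<epsilon> / 4"
  proof -
    have "0 < 1 / q - \<epsilon> / 4" "1 / q - \<epsilon> / 4 < 1 / q" using \<epsilon> by auto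
    then have "1 / (1 / q) < q2" unfolding q2_def by (intro divide_strict_left_mono) (use pq in auto)
    then show "q < q2" by simp
  qed (simp add: q2_def)
  have "(2 - \<epsilon>) * (1 / (1 - \<epsilon> / 4)) < 2" using \<epsilon> by (simp add: field_simps)
  then have "bounded_Lp_Lq (ereal q) (ereal q2) disk_area (integral_op K')"
    using \<epsilon> q2 pq by (intro bounded_integral_op_Lp_Lq[OF K'm K'_le C, of q q2 "1 / (1 - \<epsilon> / 4)"]) auto
  then have "bounded_Lp_Lq (ereal q) (ereal q) disk_area (integral_op K')"
    by (rule bounded_Lp_Lq_mono[OF prob_space_disk_area]) (use pq q2 in auto)
  then obtain B where B: "0 \<le> B"
    "\<And>f. f \<in> Lp (ereal q) disk_area \<Longrightarrow> integral_op K' f \<in> Lp (ereal q) disk_area"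
    "\<And>f. f \<in> Lp (ereal q) disk_area \<Longrightarrow>
       Lp_norm (ereal q) disk_area (integral_op K' f) \<le> B * Lp_norm (ereal q) disk_area f"
    by (auto simp: bounded_Lp_Lq_def)
  define L where "L = (\<integral>w. (1 - norm w) powr - (1 / 2) \<partial>disk_area)"
  have Li: "integrable disk_area (\<lambda>w. (1 - norm w) powr - (1 / 2))"
    by (rule integrable_one_minus_norm_powr) auto
  show ?thesis
    unfolding bounded_Lp_Lq_def
  proof (intro exI[of _ "B * L powr ((1 - q / p) / q)"] conjI ballI)
    fix f assume f: "f \<in> Lp (ereal p) disk_area"
    then have [measurable]: "f \<in> borel_measurable disk_area"
      and fi: "integrable disk_area (\<lambda>w. norm (f w) powr p)" by (auto simp: Lp_ereal_iff)
    define g where "g w = f w * of_real ((1 - norm w) powr - \<epsilon>)" for w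
    have gm: "g \<in> borel_measurable disk_area" unfolding g_def [abs_def] by measurable
    have eq: "(norm (f w) powr p) powr (q / p) * ((1 - norm w) powr - (1 / 2)) powr (1 - q / p)
        = norm (g w) powr q" for w
    proof -
      have "(norm (f w) powr p) powr (q / p) = norm (f w) powr q"
        using pq by (simp add: powr_powr)
      moreover have "((1 - norm w) powr - (1 / 2)) powr (1 - q / p) = ((1 - norm w) powr - \<epsilon>) powr q"
        by (simp add: powr_powr \<epsilon>(4)[symmetric])
      ultimately show ?thesis by (simp add: g_def norm_mult powr_mult)
    qed
    note H = Holder_integral[OF frac(1,2) _ fi _ Li, unfolded eq, simplified, folded L_def]
    have g: "g \<in> Lp (ereal q) disk_area" using H gm by (simp add: Lp_ereal_iff)
    have "Lp_norm (ereal q) disk_area g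
        \<le> ((\<integral>w. norm (f w) powr p \<partial>disk_area) powr (q / p) * L powr (1 - q / p)) powr (1 / q)"
      unfolding Lp_norm_ereal using H(2) pq by (intro powr_mono2) auto
    also have "\<dots> = L powr ((1 - q / p) / q) * Lp_norm (ereal p) disk_area f"
      using pq by (simp add: Lp_norm_ereal powr_mult powr_powr L_def)
    finally have gn: "Lp_norm (ereal q) disk_area g \<le> L powr ((1 - q / p) / q) * Lp_norm (ereal p) disk_area f" .
    have "integral_op K f = integral_op K' g"
    proof
      fix z
      show "integral_op K f z = integral_op K' g z"
        unfolding integral_op_def
      proof (rule Bochner_Integration.integral_cong[OF refl])
        fix w assume "w \<in> space disk_area"
        then have "0 < 1 - norm w" by (simp add: space_disk_area)
        then have "(1 - norm w) powr \<epsilon> * (1 - norm w) powr - \<epsilon> = 1"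
          by (simp add: powr_add[symmetric])
        then have "complex_of_real ((1 - norm w) powr \<epsilon>) * of_real ((1 - norm w) powr - \<epsilon>) = 1"
          by (metis of_real_mult of_real_1)
        then show "K z w * f w = K' z w * g w"
          by (simp add: K'_def g_def mult_ac)
      qed
    qed
    then show "integral_op K f \<in> Lp (ereal q) disk_area"
      "Lp_norm (ereal q) disk_area (integral_op K f)
        \<le> B * L powr ((1 - q / p) / q) * Lp_norm (ereal p) disk_area f"
      using B(2)[OF g] B(3)[OF g] mult_left_mono[OF gn B(1)] by (auto simp: mult.assoc)
  qed (use B in auto)
qed

section \<open>Exponents and their reciprocals\<close>

lemma ereal_reciprocal_less_iff:
  fixes x y :: ereal
  assumes "1 \<le> x" "1 \<le> y"
  shows "x < y \<longleftrightarrow> 1 / y < 1 / x"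
  using assms by (cases x; cases y) (auto simp: divide_ereal_def one_ereal_def field_simps)

lemma ereal_reciprocal_real:
  fixes x :: ereal
  assumes "1 \<le> x"
  obtains u where "1 / x = ereal u" "0 \<le> u" "u \<le> 1"
proof (cases x)
  case (real r)
  then show ?thesis
    using assms by (intro that[of "1 / r"]) (auto simp: divide_ereal_def one_ereal_def field_simps)
qed (use assms that[of 0] in \<open>auto simp: divide_ereal_def zero_ereal_def\<close>)

lemma ereal_reciprocal_eqD:
  fixes x :: ereal
  assumes "1 \<le> x" "1 / x = ereal u"
  shows "x = (if u = 0 then \<infinity> else ereal (1 / u))"
  using assms by (cases x) (auto simp: divide_ereal_def one_ereal_def field_simps)

text \<open>
  With \<open>u = 1/p\<close>, \<open>v = 1/q\<close> and \<open>k = 1/c \<in> [1/2, 1]\<close>: the conditions \<open>p < c'\<close>, \<open>p = c'\<close> and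
  \<open>p > c'\<close> on the dual exponent \<open>c'\<close> read \<open>u > 1 - k\<close>, \<open>u = 1 - k\<close> and \<open>u < 1 - k\<close>, and in each
  case the requirement on \<open>q\<close> becomes \<open>u + k - 1 < v\<close>.
\<close>

lemma exponent_conditions_iff:
  fixes p q :: ereal
  assumes pq: "1 \<le> p" "1 \<le> q" and c: "1 \<le> c" "c \<le> 2" and uv: "1 / p = ereal u" "1 / q = ereal v"
  shows "(p = 1 \<and> 1 \<le> q \<and> q < ereal c) \<or>
    (1 < p \<and> p < dual_exponent (ereal c) \<and> 1 / q > 1 / p + 1 / ereal c - 1) \<or>
    (p = dual_exponent (ereal c) \<and> 1 \<le> q \<and> q < \<infinity>) \<or>
    (p > dual_exponent (ereal c) \<and> 1 \<le> q \<and> q \<le> \<infinity>) \<longleftrightarrow> u + 1 / c - 1 < v"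
proof -
  obtain u' where "1 / p = ereal u'" "0 \<le> u'" "u' \<le> 1" using ereal_reciprocal_real[OF pq(1)] .
  with uv have u: "0 \<le> u" "u \<le> 1" by auto
  obtain v' where "1 / q = ereal v'" "0 \<le> v'" "v' \<le> 1" using ereal_reciprocal_real[OF pq(2)] .
  with uv have v: "0 \<le> v" "v \<le> 1" by auto
  have k: "1 / 2 \<le> 1 / c" "1 / c \<le> 1" using c by (auto simp: field_simps)
  have ck: "1 / ereal c = ereal (1 / c)" using c by (simp add: divide_ereal_def one_ereal_def field_simps)
  have c1: "1 \<le> ereal c" using c by (simp add: one_ereal_def)
  let ?d = "dual_exponent (ereal c)"
  have d: "1 \<le> ?d" by (rule dual_exponent(2)[OF c1])
  obtain k' where k': "1 / ?d = ereal k'" using ereal_reciprocal_real[OF d] .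
  then have "ereal (1 / c) + ereal k' = 1"
    using dual_exponent(1)[OF c1] by (simp only: ck)
  then have dk: "1 / ?d = ereal (1 - 1 / c)"
    unfolding k' by (simp add: one_ereal_def)
  have one: "1 / (1::ereal) = ereal 1" by (simp add: one_ereal_def divide_ereal_def)
  have inf: "1 / (\<infinity>::ereal) = ereal 0" by (simp add: zero_ereal_def divide_ereal_def)
  have p1: "1 < p \<longleftrightarrow> u < 1" "p = 1 \<longleftrightarrow> u = 1"
    using ereal_reciprocal_less_iff[of 1 p] pq uv one u by (auto simp: less_le)
  have qc: "q < ereal c \<longleftrightarrow> 1 / c < v"
    using ereal_reciprocal_less_iff[OF pq(2) c1] ck uv by simp
  have pd: "p < ?d \<longleftrightarrow> 1 - 1 / c < u" "?d < p \<longleftrightarrow> u < 1 - 1 / c"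
    using ereal_reciprocal_less_iff[OF pq(1) d] ereal_reciprocal_less_iff[OF d pq(1)] dk uv by simp_all
  then have pd': "p = ?d \<longleftrightarrow> u = 1 - 1 / c"
    using less_linear[of p ?d] less_linear[of u "1 - 1 / c"] by auto
  have qi: "q < \<infinity> \<longleftrightarrow> 0 < v"
    using ereal_reciprocal_less_iff[OF pq(2), of \<infinity>] inf uv by simp
  have gt: "1 / q > 1 / p + 1 / ereal c - 1 \<longleftrightarrow> u + 1 / c - 1 < v"
    unfolding uv ck by (simp add: one_ereal_def)
  show ?thesis
    unfolding p1 qc pd pd' qi gt using pq k u v by auto
qed

section \<open>The kernel of the Shimorin-type operator\<close>

lemma norm_one_minus_scaled:
  fixes u :: complex
  assumes "norm u < 1" "0 \<le> r" "r \<le> 1"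
  shows "norm (1 - u) \<le> 2 * norm (1 - of_real r * u)" and "1 - r \<le> norm (1 - of_real r * u)"
    and "0 < norm (1 - of_real r * u)"
proof -
  have ru: "norm (of_real r * u) \<le> r * 1"
    unfolding norm_mult using assms by (intro mult_mono) auto
  then show ge: "1 - r \<le> norm (1 - of_real r * u)"
    using norm_triangle_ineq2[of 1 "of_real r * u"] by simp
  have "norm (of_real (1 - r) * u) \<le> (1 - r) * 1"
    unfolding norm_mult norm_of_real using assms by (intro mult_mono) auto
  then show "norm (1 - u) \<le> 2 * norm (1 - of_real r * u)"
    using ge norm_triangle_ineq[of "1 - of_real r * u" "- (of_real (1 - r) * u)"]
    by (simp add: algebra_simps norm_minus_commute)
  have "norm (of_real r * u) \<le> 1 * norm u"
    unfolding norm_mult using assms by (intro mult_right_mono) auto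
  then show "0 < norm (1 - of_real r * u)"
    using norm_triangle_ineq2[of 1 "of_real r * u"] assms(1) by (simp del: zero_less_norm_iff)
qed

lemma critical_weight_eq:
  assumes "1 < c"
  shows "critical_weight (ereal c) r = 1 / ennreal ((1 - r\<^sup>2) powr (2 - 2 / c))"
proof -
  have "2 / dual_exponent (ereal c) = ereal (2 - 2 / c)"
    using assms by (simp add: dual_exponent_def divide_ereal_def one_ereal_def field_simps)
  then show ?thesis
    using assms by (simp add: critical_weight_def one_ereal_def)
qed

lemma Re_inverse_ge:
  fixes P :: complex
  assumes "norm (P - 1) \<le> 1 / 2"
  shows "2 / 9 \<le> Re (1 / P)"
proof -
  have re: "1 / 2 \<le> Re P"
    using abs_Re_le_cmod[of "P - 1"] assms by simp
  have n: "norm P \<le> 3 / 2"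
    using norm_triangle_ineq[of "P - 1" 1] assms by simp
  then have "(norm P)\<^sup>2 \<le> (3 / 2)\<^sup>2" by (intro power_mono) auto
  have "0 < norm P" using re by auto
  have "2 / 9 = (1 / 2) / (3 / 2 :: real)\<^sup>2" by (simp add: power2_eq_square)
  also have "\<dots> \<le> Re P / (norm P)\<^sup>2"
    using re \<open>(norm P)\<^sup>2 \<le> _\<close> \<open>0 < norm P\<close> by (intro frac_le) auto
  also have "\<dots> = Re (1 / P)" by (simp add: Re_divide cmod_power2)
  finally show ?thesis .
qed

text \<open>
  Near the point \<open>a\<close> of the real axis, \<open>1 - u\<close> and \<open>1 - r u\<close> (for \<open>u = z * cnj w\<close>) differ from the
  positive numbers \<open>A = 1 - a\<^sup>2\<close> and \<open>B = 1 - r a\<^sup>2\<close> by relative errors of at most \<open>1/8\<close>, so the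
  reciprocal of their product has real part at least \<open>2 / (9 A B)\<close>; finally \<open>A \<le> 2 (1 - a)\<close>.
\<close>

lemma Re_kernel_integrand_ge:
  fixes a r :: real
  assumes a: "0 < a" "a < 1" and r: "0 \<le> r" "r \<le> 1"
    and z: "z \<in> ball (of_real a) ((1 - a) / 16)" and w: "w \<in> ball (of_real a) ((1 - a) / 16)"
    and wD: "w \<in> \<D>"
  shows "1 / (9 * (1 - a)) * (1 / (1 - r * a\<^sup>2))
    \<le> Re (1 / (1 - z * cnj w) * (1 / (1 - of_real r * z * cnj w)))"
proof -
  define u where "u = z * cnj w"
  define A where "A = 1 - a\<^sup>2"
  define B where "B = 1 - r * a\<^sup>2"
  have a2: "a\<^sup>2 \<le> a" "0 \<le> a\<^sup>2" using a by (auto simp: power2_eq_square mult_le_cancel_left1)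
  have "r * a\<^sup>2 \<le> 1 * a\<^sup>2" using r by (intro mult_right_mono) auto
  then have AB: "1 - a \<le> A" "1 - a \<le> B" "A \<le> 2 * (1 - a)"
    using a2 zero_le_power2[of "1 - a"] by (auto simp: A_def B_def power2_diff)
  then have pos: "0 < A" "0 < B" using a by auto
  have "norm (u - of_real (a\<^sup>2)) \<le> (1 - a) / 8"
  proof -
    have "u - of_real (a\<^sup>2) = (z - of_real a) * cnj w + of_real a * cnj (w - of_real a)"
      by (simp add: u_def power2_eq_square algebra_simps)
    also have "norm \<dots> \<le> norm (z - of_real a) * norm w + a * norm (w - of_real a)"
      using norm_triangle_ineq[of "(z - of_real a) * cnj w" "of_real a * cnj (w - of_real a)"] a
      by (simp only: norm_mult complex_mod_cnj norm_of_real abs_of_pos)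
    also have "\<dots> \<le> (1 - a) / 16 * 1 + 1 * ((1 - a) / 16)"
      using z w wD a by (intro add_mono mult_mono) (auto simp: dist_norm norm_minus_commute)
    finally show ?thesis by simp
  qed
  then have uA: "norm ((1 - u) - of_real A) \<le> A / 8"
    using AB by (simp add: A_def norm_minus_commute)
  have "norm (of_real r * (u - of_real (a\<^sup>2))) \<le> 1 * ((1 - a) / 8)"
    unfolding norm_mult norm_of_real using r \<open>norm (u - of_real (a\<^sup>2)) \<le> _\<close> by (intro mult_mono) auto
  moreover have "(1 - of_real r * u) - of_real B = - (of_real r * (u - of_real (a\<^sup>2)))"
    by (simp add: B_def algebra_simps)
  ultimately have uB: "norm ((1 - of_real r * u) - of_real B) \<le> B / 8"
    using AB by (simp only: norm_minus_cancel) simp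
  define e1 where "e1 = ((1 - u) - of_real A) / of_real A"
  define e2 where "e2 = ((1 - of_real r * u) - of_real B) / of_real B"
  have e: "norm e1 \<le> 1 / 8" "norm e2 \<le> 1 / 8"
    using uA uB pos by (auto simp: e1_def e2_def norm_divide field_simps)
  have eq: "1 - u = of_real A * (1 + e1)" "1 - of_real r * u = of_real B * (1 + e2)"
    using pos by (auto simp: e1_def e2_def field_simps)
  have "norm ((1 + e1) * (1 + e2) - 1) = norm (e1 + e2 + e1 * e2)"
    by (simp add: algebra_simps)
  also have "\<dots> \<le> norm e1 + norm e2 + norm e1 * norm e2"
    by (metis norm_triangle_le norm_mult add_right_mono norm_triangle_ineq)
  also have "\<dots> \<le> 1 / 8 + 1 / 8 + 1 / 8 * (1 / 8)"
    using e by (intro add_mono mult_mono) auto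
  finally have P: "2 / 9 \<le> Re (1 / ((1 + e1) * (1 + e2)))"
    by (intro Re_inverse_ge) simp
  have re_mult: "Re v * k = Re (of_real k * v)" for v and k :: real
    by simp
  have "1 / (9 * (1 - a)) * (1 / B) = (2 / 9) * (1 / (2 * (1 - a)) * (1 / B))"
    using pos a by (simp add: divide_simps)
  also have "\<dots> \<le> Re (1 / ((1 + e1) * (1 + e2))) * (1 / A * (1 / B))"
    using P AB pos a by (intro mult_mono frac_le) auto
  also have "\<dots> = Re (of_real (1 / A * (1 / B)) * (1 / ((1 + e1) * (1 + e2))))"
    by (rule re_mult)
  also have "of_real (1 / A * (1 / B)) * (1 / ((1 + e1) * (1 + e2))) = 1 / (1 - u) * (1 / (1 - of_real r * u))"
    unfolding eq by simp
  finally show ?thesis by (simp add: B_def u_def mult.assoc)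
qed

text \<open>
  The standing hypotheses on \<open>\<nu>\<close>: a finite Borel measure on \<open>[0, 1]\<close>, possibly zero.
\<close>

locale shimorin = finite_measure \<nu> for \<nu> :: "real measure" +
  assumes sets_nu: "sets \<nu> = sets (restrict_space borel {0..1})"
begin

lemma space_nu: "space \<nu> = {0..1}"
  using sets_eq_imp_space_eq[OF sets_nu] by (simp add: space_restrict_space)

lemma measurable_ident_nu [measurable]: "(\<lambda>r. r) \<in> borel_measurable \<nu>"
  using sets_nu measurable_restrict_space1[of "\<lambda>r. r" borel borel "{0..1}"]
  by (simp cong: measurable_cong_sets)

text \<open>
  The kernel of the operator: \<open>shimorin_op \<nu>\<close> is \<open>integral_op kernel\<close>.
\<close>

definition kernel :: "complex \<Rightarrow> complex \<Rightarrow> complex"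
  where "kernel z w = 1 / (1 - z * cnj w) * (\<integral>r. 1 / (1 - complex_of_real r * z * cnj w) \<partial>\<nu>)"

lemma shimorin_op_eq: "shimorin_op \<nu> = integral_op kernel"
  by (intro ext) (simp add: shimorin_op_def integral_op_def kernel_def)

lemma measurable_kernel: "(\<lambda>(z, w). kernel z w) \<in> borel_measurable (disk_area \<Otimes>\<^sub>M disk_area)"
proof -
  let ?M = "(disk_area \<Otimes>\<^sub>M disk_area) \<Otimes>\<^sub>M \<nu>"
  have [measurable]: "(\<lambda>x. fst (fst x)) \<in> borel_measurable ?M" "(\<lambda>x. snd (fst x)) \<in> borel_measurable ?M"
    "snd \<in> borel_measurable ?M"
    by (rule measurable_compose[OF measurable_fst measurable_fst_disk]
          measurable_compose[OF measurable_fst measurable_snd_disk]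
          measurable_compose[OF measurable_snd measurable_ident_nu])+
  have "(\<lambda>x. 1 / (1 - complex_of_real (snd x) * fst (fst x) * cnj (snd (fst x)))) \<in> borel_measurable ?M"
    by measurable
  then have [measurable]: "(\<lambda>y. \<integral>r. 1 / (1 - complex_of_real r * fst y * cnj (snd y)) \<partial>\<nu>)
      \<in> borel_measurable (disk_area \<Otimes>\<^sub>M disk_area)"
    by (intro borel_measurable_lebesgue_integral) (simp add: case_prod_beta)
  show ?thesis
    unfolding kernel_def case_prod_beta by measurable
qed

text \<open>
  A bound on \<open>1 / \<bar>1 - r u\<bar>\<close> by a \<open>\<nu>\<close>-integrable function of \<open>r\<close> times a power of \<open>\<bar>1 - u\<bar>\<close>
  passes to the kernel.
\<close>

lemma norm_kernel_le_gen:
  assumes W: "integrable \<nu> W" and t: "t \<le> 1"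
    and le: "AE r in \<nu>. \<forall>u::complex. norm u < 1 \<longrightarrow> norm (1 / (1 - of_real r * u)) \<le> 2 * W r * norm (1 - u) powr (t - 1)"
    and zw: "z \<in> \<D>" "w \<in> \<D>"
  shows "norm (kernel z w) \<le> 2 * (\<integral>r. W r \<partial>\<nu>) * norm (1 - z * cnj w) powr (t - 2)"
proof -
  let ?u = "z * cnj w"
  let ?d = "norm (1 - ?u)"
  have d: "0 < ?d" by (rule one_minus_mult_cnj_pos[OF zw])
  have AE: "AE r in \<nu>. norm (1 / (1 - complex_of_real r * z * cnj w)) \<le> 2 * W r * ?d powr (t - 1)"
    using le by eventually_elim (use norm_mult_cnj_less_1[OF zw] in \<open>auto simp: mult.assoc\<close>)
  have "norm (\<integral>r. 1 / (1 - complex_of_real r * z * cnj w) \<partial>\<nu>)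
      \<le> (\<integral>r. norm (1 / (1 - complex_of_real r * z * cnj w)) \<partial>\<nu>)"
    by (rule integral_norm_bound)
  also have "\<dots> \<le> (\<integral>r. 2 * W r * ?d powr (t - 1) \<partial>\<nu>)"
  proof (rule integral_mono_AE')
    show "AE r in \<nu>. 0 \<le> 2 * W r * ?d powr (t - 1)"
      using AE by eventually_elim (meson norm_ge_zero order_trans)
  qed (use W AE in auto)
  also have "\<dots> = 2 * (\<integral>r. W r \<partial>\<nu>) * ?d powr (t - 1)" by simp
  finally have "norm (kernel z w) \<le> (1 / ?d) * (2 * (\<integral>r. W r \<partial>\<nu>) * ?d powr (t - 1))"
    unfolding kernel_def norm_mult norm_divide norm_one by (rule mult_left_mono) simp
  also have "1 / ?d = ?d powr - 1" using d by (simp add: powr_minus_divide)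
  also have "?d powr - 1 * (2 * (\<integral>r. W r \<partial>\<nu>) * ?d powr (t - 1))
      = 2 * (\<integral>r. W r \<partial>\<nu>) * (?d powr - 1 * ?d powr (t - 1))" by (simp only: mult_ac)
  also have "?d powr - 1 * ?d powr (t - 1) = ?d powr (t - 2)"
    by (simp only: powr_add[symmetric]) simp
  finally show ?thesis .
qed

lemma norm_kernel_le_Bergman:
  assumes "z \<in> \<D>" "w \<in> \<D>"
  shows "norm (kernel z w) \<le> 2 * measure \<nu> (space \<nu>) * norm (1 - z * cnj w) powr - 2"
proof -
  have "AE r in \<nu>. \<forall>u::complex. norm u < 1 \<longrightarrow> norm (1 / (1 - of_real r * u)) \<le> 2 * 1 * norm (1 - u) powr (0 - 1)"
  proof (intro AE_I2 allI impI)
    fix r u assume "r \<in> space \<nu>" and u: "norm (u::complex) < 1"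
    then have r: "0 \<le> r" "r \<le> 1" by (auto simp: space_nu)
    have "u \<noteq> 1" using u by auto
    then have d: "0 < norm (1 - u)" by simp
    have "1 / norm (1 - of_real r * u) \<le> 2 / norm (1 - u)"
      using norm_one_minus_scaled[OF u r] d by (simp add: field_simps)
    then show "norm (1 / (1 - of_real r * u)) \<le> 2 * 1 * norm (1 - u) powr (0 - 1)"
      using d by (simp add: norm_divide powr_minus_divide)
  qed
  then show ?thesis
    using norm_kernel_le_gen[of "\<lambda>_. 1" 0, OF _ _ _ assms] by simp
qed

text \<open>
  With \<open>t = 2 - 2/c\<close>, the two lower bounds for \<open>\<bar>1 - r u\<bar>\<close> are combined with the weights
  \<open>t\<close> and \<open>1 - t\<close>. Finiteness of the integral of the weight excludes an atom of \<open>\<nu>\<close> at 1 when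
  \<open>c > 1\<close>.
\<close>

lemma norm_kernel_le:
  assumes c: "1 \<le> c" "c < 2" and fin: "(\<integral>\<^sup>+ r. critical_weight (ereal c) r \<partial>\<nu>) < \<infinity>"
  obtains C where "0 \<le> C"
    "\<And>z w. z \<in> \<D> \<Longrightarrow> w \<in> \<D> \<Longrightarrow> norm (kernel z w) \<le> C * norm (1 - z * cnj w) powr - (2 / c)"
proof (cases "c = 1")
  case True
  then show ?thesis
    using norm_kernel_le_Bergman that[of "2 * measure \<nu> (space \<nu>)"] by simp
next
  case False
  with c have "1 < c" by simp
  define t where "t = 2 - 2 / c"
  have t: "0 < t" "t < 1" using c \<open>1 < c\<close> by (auto simp: t_def field_simps)
  have fin': "(\<integral>\<^sup>+ r. 1 / ennreal ((1 - r\<^sup>2) powr t) \<partial>\<nu>) \<noteq> \<infinity>"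
    using fin by (simp add: critical_weight_eq[OF \<open>1 < c\<close>] t_def)
  let ?W = "\<lambda>r. (1 - r\<^sup>2) powr - t"
  have AE: "AE r in \<nu>. r \<noteq> 1"
  proof -
    have "AE r in \<nu>. 1 / ennreal ((1 - r\<^sup>2) powr t) \<noteq> \<infinity>"
      by (rule nn_integral_PInf_AE[OF _ fin']) measurable
    then show ?thesis by eventually_elim auto
  qed
  have W: "integrable \<nu> ?W"
  proof (rule integrableI_nonneg)
    have "(\<integral>\<^sup>+ r. ennreal (?W r) \<partial>\<nu>) = (\<integral>\<^sup>+ r. 1 / ennreal ((1 - r\<^sup>2) powr t) \<partial>\<nu>)"
    proof (rule nn_integral_cong_AE, use AE AE_space in eventually_elim)
      fix r assume "r \<noteq> 1" "r \<in> space \<nu>"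
      then have "r\<^sup>2 < 1" by (auto simp: space_nu power_less_one_iff abs_square_less_1)
      then show "ennreal (?W r) = 1 / ennreal ((1 - r\<^sup>2) powr t)"
        by (subst ennreal_1[symmetric], subst divide_ennreal) (auto simp: powr_minus_divide)
    qed
    then show "(\<integral>\<^sup>+ r. ennreal (?W r) \<partial>\<nu>) < \<infinity>" using fin' by (simp add: less_top)
  qed auto
  have le: "AE r in \<nu>. \<forall>u::complex. norm u < 1 \<longrightarrow> norm (1 / (1 - of_real r * u)) \<le> 2 * ?W r * norm (1 - u) powr (t - 1)"
    using AE AE_space
  proof (eventually_elim, intro allI impI)
    fix r and u :: complex assume "r \<noteq> 1" "r \<in> space \<nu>" and u: "norm u < 1"
    then have r: "0 \<le> r" "r < 1" by (auto simp: space_nu)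
    have r2: "(1 - r\<^sup>2) / 2 \<le> 1 - r" "0 < 1 - r\<^sup>2"
      using r zero_le_power2[of "1 - r"] by (auto simp: power2_diff abs_square_less_1)
    have "u \<noteq> 1" using u by auto
    then have d: "0 < norm (1 - u)" by simp
    let ?e = "norm (1 - of_real r * u)"
    note e = norm_one_minus_scaled[OF u r(1) less_imp_le[OF r(2)]]
    have "norm (1 / (1 - of_real r * u)) = ?e powr - 1"
      using e(3) by (simp add: norm_divide powr_minus_divide)
    also have "\<dots> = ?e powr - t * ?e powr (t - 1)"
      by (simp add: powr_add[symmetric])
    also have "\<dots> \<le> ((1 - r\<^sup>2) / 2) powr - t * (norm (1 - u) / 2) powr (t - 1)"
      using e t r2 d by (intro mult_mono powr_mono2') auto
    also have "\<dots> = (1 / 2) powr - t * (1 / 2) powr (t - 1) * (?W r * norm (1 - u) powr (t - 1))"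
      using r2 d by (simp add: powr_divide)
    also have "(1 / 2) powr - t * (1 / 2) powr (t - 1) = (2::real)"
      by (simp only: powr_add[symmetric]) (simp add: powr_minus_divide)
    finally show "norm (1 / (1 - of_real r * u)) \<le> 2 * ?W r * norm (1 - u) powr (t - 1)"
      by (simp add: mult.assoc)
  qed
  have "t - 2 = - (2 / c)" by (simp add: t_def)
  then show ?thesis
    using norm_kernel_le_gen[OF W _ le] t that[of "2 * (\<integral>r. ?W r \<partial>\<nu>)"] by simp
qed

section \<open>The strict inequality suffices\<close>

lemma critical_index_real:
  obtains c where "critical_index \<nu> = ereal c" "1 \<le> c" "c \<le> 2"
proof -
  have "critical_weight 1 = (\<lambda>r. 1)" by (simp add: critical_weight_def fun_eq_iff)
  then have ge: "1 \<le> critical_index \<nu>"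
    unfolding critical_index_def by (intro Sup_upper) (simp add: less_top[symmetric])
  have le: "critical_index \<nu> \<le> 2" unfolding critical_index_def by (rule Sup_least) auto
  obtain c where "critical_index \<nu> = ereal c"
    using ge le by (cases "critical_index \<nu>") auto
  with ge le show ?thesis by (intro that[of c]) (auto simp: one_ereal_def)
qed

lemma less_critical_index:
  assumes c: "critical_index \<nu> = ereal c" and "y < c"
  obtains c1 where "y < c1" "1 \<le> c1" "c1 < 2" "(\<integral>\<^sup>+ r. critical_weight (ereal c1) r \<partial>\<nu>) < \<infinity>"
proof -
  have "ereal y < critical_index \<nu>" using assms by simp
  then obtain x where x: "1 \<le> x" "x < 2" "(\<integral>\<^sup>+ r. critical_weight x r \<partial>\<nu>) < \<infinity>" "ereal y < x"
    unfolding critical_index_def less_Sup_iff by auto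
  then obtain c1 where "x = ereal c1" by (cases x) auto
  with x show ?thesis by (intro that[of c1]) (auto simp: one_ereal_def)
qed

lemma critical_index_upper:
  assumes c: "critical_index \<nu> = ereal c"
    and c1: "1 \<le> c1" "c1 < 2" "(\<integral>\<^sup>+ r. critical_weight (ereal c1) r \<partial>\<nu>) < \<infinity>"
  shows "c1 \<le> c"
proof -
  have "ereal c1 \<le> critical_index \<nu>"
    unfolding critical_index_def using c1 by (intro Sup_upper) (simp add: one_ereal_def)
  with c show ?thesis by simp
qed

lemma bounded_shimorin_op_finite:
  assumes c: "critical_index \<nu> = ereal c" and pq: "1 \<le> p" "1 \<le> q" and less: "1 / p + 1 / c - 1 < 1 / q"
  shows "bounded_Lp_Lq (ereal p) (ereal q) disk_area (shimorin_op \<nu>)"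
proof -
  have c12: "1 \<le> c" "c \<le> 2"
    by (rule critical_index_real; use c in simp)+
  show ?thesis
  proof (cases "c = 1")
    case True
    with less have "1 / p < 1 / q" by simp
    then have "q < p" using pq by (simp add: field_simps)
    then show ?thesis
      unfolding shimorin_op_eq using pq
      by (intro bounded_integral_op_Bergman[OF measurable_kernel norm_kernel_le_Bergman]) auto
  next
    case False
    with c12 have "1 / c < 1" by simp
    \<comment> \<open>The target exponent is raised to \<open>q' = 1/v > p\<close>, as the kernel estimate requires.\<close>
    have "\<exists>v>0. v \<le> 1 / q \<and> v < 1 / p \<and> 1 / p + 1 / c - 1 < v"
    proof (cases "p < q")
      case True
      then show ?thesis using less pq by (intro exI[of _ "1 / q"]) (auto simp: field_simps)
    next
      case False
      then have "1 / p \<le> 1 / q" using pq by (simp add: field_simps)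
      moreover obtain v where "max 0 (1 / p + 1 / c - 1) < v" "v < 1 / p"
        using dense[of "max 0 (1 / p + 1 / c - 1)" "1 / p"] \<open>1 / c < 1\<close> pq by auto
      ultimately show ?thesis by (intro exI[of _ v]) auto
    qed
    then obtain v where v: "0 < v" "v \<le> 1 / q" "v < 1 / p" "1 / p + 1 / c - 1 < v" by blast
    define q' where "q' = 1 / v"
    have q': "1 / q' = v" "p < q'" "q \<le> q'"
      using v pq by (auto simp: q'_def field_simps)
    define m where "m = 1 / (v - 1 / p + 1)"
    have "0 < 1 / c" using c12 by simp
    then have pos: "0 < v - 1 / p + 1" "1 / c < v - 1 / p + 1" using v by linarith+
    have "m < 1 / (1 / c)"
      unfolding m_def
      by (rule divide_strict_left_mono[OF pos(2) zero_less_one mult_pos_pos[OF pos(1) \<open>0 < 1 / c\<close>]])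
    then have "m < c" by simp
    then obtain c1 where c1: "m < c1" "1 \<le> c1" "c1 < 2" "(\<integral>\<^sup>+ r. critical_weight (ereal c1) r \<partial>\<nu>) < \<infinity>"
      using less_critical_index[OF c] by blast
    obtain C where C: "0 \<le> C"
      "\<And>z w. z \<in> \<D> \<Longrightarrow> w \<in> \<D> \<Longrightarrow> norm (kernel z w) \<le> C * norm (1 - z * cnj w) powr - (2 / c1)"
      using norm_kernel_le[OF c1(2-4)] by blast
    have "bounded_Lp_Lq (ereal p) (ereal q') disk_area (integral_op kernel)"
      by (rule bounded_integral_op_Lp_Lq[OF measurable_kernel C(2) C(1), of p q' m])
        (use pq q' c1 pos in \<open>auto simp: m_def divide_less_eq\<close>)
    then show ?thesis
      unfolding shimorin_op_eq
      by (rule bounded_Lp_Lq_mono[OF prob_space_disk_area]) (use pq q' in auto)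
  qed
qed

lemma bounded_shimorin_op_infinity:
  assumes c: "critical_index \<nu> = ereal c" and p: "1 \<le> p" and less: "1 / p + 1 / c - 1 < 0"
  shows "bounded_Lp_Lq (ereal p) \<infinity> disk_area (shimorin_op \<nu>)"
proof -
  have c12: "1 \<le> c" "c \<le> 2"
    by (rule critical_index_real; use c in simp)+
  have "0 < 1 / c" using c12 by simp
  have pos: "0 < 1 - 1 / p" "1 / c < 1 - 1 / p" using less \<open>0 < 1 / c\<close> by linarith+
  then have p1: "1 < p" using p by (auto simp: field_simps)
  have "1 / (1 - 1 / p) < 1 / (1 / c)"
    by (rule divide_strict_left_mono[OF pos(2) zero_less_one mult_pos_pos[OF pos(1) \<open>0 < 1 / c\<close>]])
  then have "1 / (1 - 1 / p) < c" by simp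
  then obtain c1 where c1: "1 / (1 - 1 / p) < c1" "1 \<le> c1" "c1 < 2" "(\<integral>\<^sup>+ r. critical_weight (ereal c1) r \<partial>\<nu>) < \<infinity>"
    using less_critical_index[OF c] by blast
  obtain C where C: "0 \<le> C"
    "\<And>z w. z \<in> \<D> \<Longrightarrow> w \<in> \<D> \<Longrightarrow> norm (kernel z w) \<le> C * norm (1 - z * cnj w) powr - (2 / c1)"
    using norm_kernel_le[OF c1(2-4)] by blast
  have "2 / c1 / (1 - 1 / p) < 2"
  proof -
    have "2 / c1 / (1 - 1 / p) = 2 * ((1 / (1 - 1 / p)) / c1)" by simp
    also have "\<dots> < 2 * 1" using c1(1,2) by (intro mult_strict_left_mono) (simp_all add: divide_less_eq_1_pos del: divide_divide_eq_left)
    finally show ?thesis by simp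
  qed
  then show ?thesis
    unfolding shimorin_op_eq
    by (intro bounded_integral_op_Lp_infinity[OF measurable_kernel C(2) C(1)]) (use p1 c1 in auto)
qed

lemma bounded_shimorin_op:
  assumes c: "critical_index \<nu> = ereal c" "1 \<le> c"
    and pq: "1 \<le> p" "1 \<le> q" and uv: "1 / p = ereal u" "1 / q = ereal v"
    and less: "u + 1 / c - 1 < v"
  shows "bounded_Lp_Lq p q disk_area (shimorin_op \<nu>)"
proof -
  have "1 / c \<le> 1" "0 < 1 / c" using c by simp_all
  obtain u' where "1 / p = ereal u'" "0 \<le> u'" "u' \<le> 1" using ereal_reciprocal_real[OF pq(1)] .
  with uv have u: "0 \<le> u" "u \<le> 1" by auto
  obtain v' where "1 / q = ereal v'" "0 \<le> v'" "v' \<le> 1" using ereal_reciprocal_real[OF pq(2)] .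
  with uv have v: "0 \<le> v" "v \<le> 1" by auto
  \<comment> \<open>A source exponent \<open>p = \<infinity>\<close> is lowered to a large finite one.\<close>
  obtain u1 where u1: "0 < u1" "u \<le> u1" "u1 \<le> 1" "u1 + 1 / c - 1 < v"
  proof (cases "u = 0")
    case True
    have ex: "\<exists>u1>0. u1 \<le> 1 \<and> u1 + k - 1 < v" if "k \<le> 1" "0 < k" "k - 1 < v" for k
      using that v by (intro exI[of _ "(v - (k - 1)) / 2"]) (auto simp: field_simps)
    have "1 / c - 1 < v" using True less by simp
    from ex[OF \<open>1 / c \<le> 1\<close> \<open>0 < 1 / c\<close> this] obtain u1 where "0 < u1" "u1 \<le> 1" "u1 + 1 / c - 1 < v" by blast
    then show ?thesis using True by (intro that[of u1]) auto
  next
    case False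
    then show ?thesis using less u by (intro that[of u]) auto
  qed
  have "ereal (1 / u1) \<le> p"
    using ereal_reciprocal_eqD[OF pq(1) uv(1)] u u1 by (auto simp: field_simps)
  moreover have "bounded_Lp_Lq (ereal (1 / u1)) q disk_area (shimorin_op \<nu>)"
  proof (cases "v = 0")
    case True
    then have "q = \<infinity>" using ereal_reciprocal_eqD[OF pq(2) uv(2)] by simp
    then show ?thesis
      using u1 True by (auto intro!: bounded_shimorin_op_infinity[OF c(1)])
  next
    case False
    then have "q = ereal (1 / v)" using ereal_reciprocal_eqD[OF pq(2) uv(2)] by simp
    then show ?thesis
      using u1 v False by (auto intro!: bounded_shimorin_op_finite[OF c(1)])
  qed
  ultimately show ?thesis
    using u1 pq by - (rule bounded_Lp_Lq_mono[OF prob_space_disk_area, of "ereal (1 / u1)" q], auto)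
qed

section \<open>Boundedness implies the weak inequality\<close>

lemma Re_kernel_ge:
  assumes a: "0 < a" "a < 1"
    and z: "z \<in> ball (of_real a) ((1 - a) / 16)" "z \<in> \<D>"
    and w: "w \<in> ball (of_real a) ((1 - a) / 16)" "w \<in> \<D>"
  shows "1 / (9 * (1 - a)) * (\<integral>r. 1 / (1 - r * a\<^sup>2) \<partial>\<nu>) \<le> Re (kernel z w)"
proof -
  let ?F = "\<lambda>r. 1 / (1 - z * cnj w) * (1 / (1 - complex_of_real r * z * cnj w))"
  have d: "0 < norm (1 - z * cnj w)" by (rule one_minus_mult_cnj_pos) (use z w in auto)
  have int: "integrable \<nu> (\<lambda>r. 1 / (1 - complex_of_real r * z * cnj w))"
  proof (rule integrable_const_bound)
    show "AE r in \<nu>. norm (1 / (1 - complex_of_real r * z * cnj w)) \<le> 2 / norm (1 - z * cnj w)"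
    proof (rule AE_I2)
      fix r assume "r \<in> space \<nu>"
      then have r: "0 \<le> r" "r \<le> 1" by (auto simp: space_nu)
      show "norm (1 / (1 - complex_of_real r * z * cnj w)) \<le> 2 / norm (1 - z * cnj w)"
        using norm_one_minus_scaled[OF norm_mult_cnj_less_1 r, of z w] z w d
        by (simp add: norm_divide mult.assoc field_simps)
    qed
  qed measurable
  have a2: "a\<^sup>2 < 1" using a by (simp add: abs_square_less_1)
  have int_a: "integrable \<nu> (\<lambda>r. 1 / (1 - r * a\<^sup>2))"
  proof (rule integrable_const_bound)
    show "AE r in \<nu>. norm (1 / (1 - r * a\<^sup>2)) \<le> 1 / (1 - a\<^sup>2)"
    proof (rule AE_I2)
      fix r assume "r \<in> space \<nu>"
      then have "r * a\<^sup>2 \<le> 1 * a\<^sup>2" by (intro mult_right_mono) (auto simp: space_nu)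
      then show "norm (1 / (1 - r * a\<^sup>2)) \<le> 1 / (1 - a\<^sup>2)"
        using a2 by (simp add: field_simps)
    qed
  qed measurable
  have "1 / (9 * (1 - a)) * (\<integral>r. 1 / (1 - r * a\<^sup>2) \<partial>\<nu>) = (\<integral>r. 1 / (9 * (1 - a)) * (1 / (1 - r * a\<^sup>2)) \<partial>\<nu>)"
    by (rule integral_mult_right_zero[symmetric])
  also have "\<dots> \<le> (\<integral>r. Re (?F r) \<partial>\<nu>)"
  proof (rule integral_mono)
    show "1 / (9 * (1 - a)) * (1 / (1 - r * a\<^sup>2)) \<le> Re (?F r)" if "r \<in> space \<nu>" for r
      using that by (intro Re_kernel_integrand_ge[OF a _ _ z(1) w]) (auto simp: space_nu)
    show "integrable \<nu> (\<lambda>r. Re (?F r))" by (intro integrable_Re integrable_mult_right int)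
    show "integrable \<nu> (\<lambda>r. 1 / (9 * (1 - a)) * (1 / (1 - r * a\<^sup>2)))" by (intro integrable_mult_right int_a)
  qed
  also have "\<dots> = Re (\<integral>r. ?F r \<partial>\<nu>)"
    by (intro integral_Re integrable_mult_right int)
  also have "(\<integral>r. ?F r \<partial>\<nu>) = kernel z w" unfolding kernel_def by (rule integral_mult_right_zero)
  finally show ?thesis .
qed

text \<open>
  The operator is tested on the indicator \<open>f\<close> of the disk \<open>S\<close> of radius \<open>\<delta> = x/16\<close> about
  \<open>a = 1 - x\<close>. Its norm is \<open>\<delta> powr (2/p)\<close>, and on \<open>S\<close>, of area \<open>\<delta>\<^sup>2\<close>, the image has absolute
  value at least \<open>L \<delta>\<^sup>2\<close>, where \<open>L\<close> is the lower bound for the real part of the kernel.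
\<close>

lemma integral_shimorin_weight_le:
  assumes pq: "1 \<le> p" "1 \<le> q" and bdd: "bounded_Lp_Lq (ereal p) (ereal q) disk_area (shimorin_op \<nu>)"
  obtains C where "0 \<le> C"
    "\<And>x. 0 < x \<Longrightarrow> x < 1 \<Longrightarrow> (\<integral>r. 1 / (1 - r * (1 - x)\<^sup>2) \<partial>\<nu>) \<le> C * x powr (2 / p - 2 / q - 1)"
proof -
  obtain C where C: "0 \<le> C" "\<And>f. f \<in> Lp (ereal p) disk_area \<Longrightarrow> shimorin_op \<nu> f \<in> Lp (ereal q) disk_area"
    "\<And>f. f \<in> Lp (ereal p) disk_area \<Longrightarrow>
       Lp_norm (ereal q) disk_area (shimorin_op \<nu> f) \<le> C * Lp_norm (ereal p) disk_area f"
    using bdd by (auto simp: bounded_Lp_Lq_def)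
  show ?thesis
  proof (rule that)
    show "0 \<le> 144 * C * 16 powr (1 - (2 / p - 2 / q))" using C by simp
    fix x :: real assume x: "0 < x" "x < 1"
    define a where "a = 1 - x"
    define \<delta> where "\<delta> = x / 16"
    have a: "0 < a" "a < 1" and \<delta>: "0 < \<delta>" "\<delta> = (1 - a) / 16" using x by (auto simp: a_def \<delta>_def)
    define S where "S = ball (complex_of_real a) \<delta>"
    have S: "S \<subseteq> \<D>"
    proof
      fix w assume "w \<in> S"
      then have "norm (w - of_real a) < \<delta>" by (simp add: S_def dist_norm norm_minus_commute)
      then show "w \<in> \<D>"
        using norm_triangle_ineq[of "w - of_real a" "of_real a"] a \<delta> by simp
    qed
    then have [measurable]: "S \<in> sets disk_area" by (simp add: sets_disk_area_iff S_def)
    have mS: "measure disk_area S = \<delta>\<^sup>2"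
      using S \<delta>(1) by (simp add: S_def measure_disk_area_ball)
    let ?f = "\<lambda>w. indicator S w :: complex"
    define \<phi> where "\<phi> = (\<integral>r. 1 / (1 - r * a\<^sup>2) \<partial>\<nu>)"
    define L where "L = 1 / (9 * x) * \<phi>"
    have \<phi>0: "0 \<le> \<phi>"
      unfolding \<phi>_def
    proof (rule Bochner_Integration.integral_nonneg)
      fix r assume "r \<in> space \<nu>"
      then have "r * a\<^sup>2 \<le> 1 * a\<^sup>2" by (intro mult_right_mono) (auto simp: space_nu)
      moreover have "a\<^sup>2 \<le> 1" using a by (simp add: abs_square_le_1)
      ultimately show "0 \<le> 1 / (1 - r * a\<^sup>2)" by simp
    qed
    have L0: "0 \<le> L" using \<phi>0 x by (simp add: L_def)
    have d2: "\<delta>\<^sup>2 = \<delta> powr 2" using \<delta>(1) by simp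
    have f_powr: "norm (?f w) powr p = indicator S w" for w using pq by (simp add: indicator_def)
    have iS: "integrable disk_area (\<lambda>w. indicator S w :: real)"
      by (rule disk.integrable_const_bound[where B = 1]) (auto simp: indicator_def)
    have f: "?f \<in> Lp (ereal p) disk_area"
      unfolding Lp_ereal_iff f_powr by (intro conjI borel_measurable_indicator iS) fact
    have fn: "Lp_norm (ereal p) disk_area ?f = \<delta> powr (2 / p)"
      unfolding Lp_norm_ereal f_powr using mS d2 by (simp add: powr_powr)
    have Tge: "L * \<delta>\<^sup>2 \<le> norm (shimorin_op \<nu> ?f z)" if z: "z \<in> S" for z
    proof -
      have zD: "z \<in> \<D>" using z S by auto
      have Km: "(\<lambda>w. kernel z w) \<in> borel_measurable disk_area"
        using measurable_compose_Pair1[OF _ measurable_kernel, of z] zD by (simp add: space_disk_area)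
      have int: "integrable disk_area (\<lambda>w. kernel z w * ?f w)"
      proof (rule disk.integrable_const_bound)
        show "AE w in disk_area. norm (kernel z w * ?f w)
            \<le> 2 * measure \<nu> (space \<nu>) * (1 - norm z) powr - 2"
        proof (rule AE_I2)
          fix w assume "w \<in> space disk_area"
          then have wD: "w \<in> \<D>" by (simp add: space_disk_area)
          have "norm (kernel z w * ?f w) \<le> norm (kernel z w)"
            by (simp add: indicator_def)
          also have "\<dots> \<le> 2 * measure \<nu> (space \<nu>) * norm (1 - z * cnj w) powr - 2"
            by (rule norm_kernel_le_Bergman[OF zD wD])
          also have "\<dots> \<le> 2 * measure \<nu> (space \<nu>) * (1 - norm z) powr - 2"
            using one_minus_mult_cnj_ge[OF wD zD] norm_one_minus_mult_cnj_commute[of z w] zD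
            by (intro mult_left_mono powr_mono2') auto
          finally show "norm (kernel z w * ?f w) \<le> 2 * measure \<nu> (space \<nu>) * (1 - norm z) powr - 2" .
        qed
        show "(\<lambda>w. kernel z w * ?f w) \<in> borel_measurable disk_area" using Km by measurable
      qed
      have "L * \<delta>\<^sup>2 = (\<integral>w. L * indicator S w \<partial>disk_area)"
        using mS by simp
      also have "\<dots> \<le> (\<integral>w. Re (kernel z w * ?f w) \<partial>disk_area)"
      proof (rule integral_mono)
        show "integrable disk_area (\<lambda>w. L * indicator S w)"
          by (intro integrable_mult_right iS)
        show "integrable disk_area (\<lambda>w. Re (kernel z w * ?f w))"
          by (rule integrable_Re[OF int])
        show "L * indicator S w \<le> Re (kernel z w * ?f w)" for w
          using Re_kernel_ge[OF a, of z w] z S \<delta>(2)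
          by (auto simp: indicator_def L_def \<phi>_def S_def a_def subset_iff)
      qed
      also have "\<dots> = Re (shimorin_op \<nu> ?f z)"
        unfolding shimorin_op_eq integral_op_def by (rule integral_Re[OF int])
      also have "\<dots> \<le> norm (shimorin_op \<nu> ?f z)" by (rule complex_Re_le_cmod)
      finally show ?thesis .
    qed
    have Tf: "integrable disk_area (\<lambda>z. norm (shimorin_op \<nu> ?f z) powr q)"
      using C(2)[OF f] by (simp add: Lp_ereal_iff)
    have "(L * \<delta>\<^sup>2) powr q * \<delta>\<^sup>2 = (\<integral>z. (L * \<delta>\<^sup>2) powr q * indicator S z \<partial>disk_area)"
      using mS by simp
    also have "\<dots> \<le> (\<integral>z. norm (shimorin_op \<nu> ?f z) powr q \<partial>disk_area)"
    proof (rule integral_mono[OF _ Tf])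
      show "integrable disk_area (\<lambda>z. (L * \<delta>\<^sup>2) powr q * indicator S z)"
        by (intro integrable_mult_right iS)
      show "(L * \<delta>\<^sup>2) powr q * indicator S z \<le> norm (shimorin_op \<nu> ?f z) powr q" for z
        using Tge[of z] L0 pq by (auto simp: indicator_def intro!: powr_mono2)
    qed
    finally have "((L * \<delta>\<^sup>2) powr q * \<delta>\<^sup>2) powr (1 / q) \<le> Lp_norm (ereal q) disk_area (shimorin_op \<nu> ?f)"
      unfolding Lp_norm_ereal using pq by (intro powr_mono2) auto
    also have "\<dots> \<le> C * \<delta> powr (2 / p)"
      using C(3)[OF f] by (simp add: fn)
    also have "((L * \<delta>\<^sup>2) powr q * \<delta>\<^sup>2) powr (1 / q) = L * \<delta> powr (2 + 2 / q)"
      unfolding d2 using L0 pq by (simp add: powr_mult powr_powr powr_add)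
    finally have "L * \<delta> powr (2 + 2 / q) * \<delta> powr - (2 + 2 / q) \<le> C * \<delta> powr (2 / p) * \<delta> powr - (2 + 2 / q)"
      by (rule mult_right_mono) simp
    moreover have "\<delta> powr (2 + 2 / q) * \<delta> powr - (2 + 2 / q) = 1"
      using \<delta>(1) by (simp only: powr_add[symmetric]) simp
    moreover have "\<delta> powr (2 / p) * \<delta> powr - (2 + 2 / q) = \<delta> powr (2 / p - 2 / q - 2)"
      by (simp only: powr_add[symmetric]) (simp add: algebra_simps)
    ultimately have "L \<le> C * \<delta> powr (2 / p - 2 / q - 2)"
      by (simp only: mult.assoc mult_1_right)
    then have "9 * x * L \<le> 9 * x * (C * \<delta> powr (2 / p - 2 / q - 2))"
      using x by (intro mult_left_mono) auto
    also have "9 * x * L = \<phi>" using x by (simp add: L_def)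
    also have "9 * x * (C * \<delta> powr (2 / p - 2 / q - 2)) = 144 * C * (\<delta> powr 1 * \<delta> powr (2 / p - 2 / q - 2))"
      using \<delta>(1) by (simp add: \<delta>_def)
    also have "\<delta> powr 1 * \<delta> powr (2 / p - 2 / q - 2) = \<delta> powr (2 / p - 2 / q - 1)"
      by (simp only: powr_add[symmetric]) simp
    also have "\<dots> = 16 powr (1 - (2 / p - 2 / q)) * x powr (2 / p - 2 / q - 1)"
      using x powr_minus_divide[of 16 "2 / p - 2 / q - 1"] by (simp add: \<delta>_def powr_divide)
    finally show "(\<integral>r. 1 / (1 - r * (1 - x)\<^sup>2) \<partial>\<nu>)
        \<le> 144 * C * 16 powr (1 - (2 / p - 2 / q)) * x powr (2 / p - 2 / q - 1)"
      by (simp add: \<phi>_def a_def mult.assoc)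
  qed
qed

lemma integrable_shimorin_weight:
  assumes x: "0 < x" "x < 1"
  shows "integrable \<nu> (\<lambda>r. 1 / (1 - r * (1 - x)\<^sup>2))"
    and "r \<in> space \<nu> \<Longrightarrow> 1 \<le> 1 / (1 - r * (1 - x)\<^sup>2)"
    and "r \<in> space \<nu> \<Longrightarrow> 1 - r \<le> x \<Longrightarrow> 1 / (3 * x) \<le> 1 / (1 - r * (1 - x)\<^sup>2)"
proof -
  have x2: "(1 - x)\<^sup>2 < 1" using x by (simp add: abs_square_less_1)
  have le: "r * (1 - x)\<^sup>2 \<le> 1 * (1 - x)\<^sup>2" "0 \<le> r * (1 - x)\<^sup>2" if "r \<in> space \<nu>" for r
    using that by (auto intro!: mult_left_le_one_le simp: space_nu)
  show "integrable \<nu> (\<lambda>r. 1 / (1 - r * (1 - x)\<^sup>2))"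
  proof (rule integrable_const_bound)
    show "AE r in \<nu>. norm (1 / (1 - r * (1 - x)\<^sup>2)) \<le> 1 / (1 - (1 - x)\<^sup>2)"
    proof (rule AE_I2)
      fix r assume "r \<in> space \<nu>"
      then have "1 - (1 - x)\<^sup>2 \<le> 1 - r * (1 - x)\<^sup>2" using le(1) by simp
      moreover have "0 < 1 - (1 - x)\<^sup>2" using x2 by simp
      ultimately show "norm (1 / (1 - r * (1 - x)\<^sup>2)) \<le> 1 / (1 - (1 - x)\<^sup>2)"
        unfolding real_norm_def by (subst abs_of_pos) (auto intro: divide_left_mono)
    qed
  qed measurable
  show "1 \<le> 1 / (1 - r * (1 - x)\<^sup>2)" if "r \<in> space \<nu>"
    using le[OF that] x2 by (simp add: field_simps)
  show "1 / (3 * x) \<le> 1 / (1 - r * (1 - x)\<^sup>2)" if r: "r \<in> space \<nu>" "1 - r \<le> x"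
  proof -
    have "(1 - x) * (1 - x)\<^sup>2 \<le> r * (1 - x)\<^sup>2" using r by (intro mult_right_mono) auto
    moreover have "1 - 3 * x \<le> (1 - x) * (1 - x)\<^sup>2"
    proof -
      have "(1 - x) * (1 - x)\<^sup>2 - (1 - 3 * x) = x * x * (3 - x)"
        by (simp add: power2_eq_square algebra_simps)
      also have "\<dots> \<ge> 0" using x by simp
      finally show ?thesis by simp
    qed
    ultimately have "1 - r * (1 - x)\<^sup>2 \<le> 3 * x" by linarith
    moreover have "0 < 1 - r * (1 - x)\<^sup>2" using le[OF r(1)] x2 by simp
    ultimately show ?thesis using x by (intro divide_left_mono) auto
  qed
qed

text \<open>
  The conclusion for finite exponents. The bound \<open>\<beta> \<le> 1\<close> is needed because the critical index is
  a supremum over \<open>c < 2\<close> only, so the tail estimate alone would not exclude \<open>\<beta> > 1\<close>.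
\<close>

lemma critical_index_ge_of_bounded:
  assumes c: "critical_index \<nu> = ereal c" and nz: "emeasure \<nu> (space \<nu>) \<noteq> 0"
    and pq: "1 \<le> p" "1 \<le> q" and bdd: "bounded_Lp_Lq (ereal p) (ereal q) disk_area (shimorin_op \<nu>)"
  shows "1 / p + 1 / c - 1 \<le> 1 / q"
proof -
  have c12: "1 \<le> c" "c \<le> 2"
    by (rule critical_index_real; use c in simp)+
  define \<beta> where "\<beta> = 2 / p - 2 / q"
  obtain C where C: "0 \<le> C"
    "\<And>x. 0 < x \<Longrightarrow> x < 1 \<Longrightarrow> (\<integral>r. 1 / (1 - r * (1 - x)\<^sup>2) \<partial>\<nu>) \<le> C * x powr (\<beta> - 1)"
    using integral_shimorin_weight_le[OF pq bdd] unfolding \<beta>_def by blast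
  define \<mu> where "\<mu> = measure \<nu> (space \<nu>)"
  have \<mu>: "0 < \<mu>"
    using nz by (simp add: \<mu>_def emeasure_eq_measure zero_less_measure_iff)
  have \<beta>1: "\<beta> \<le> 1"
  proof (rule ccontr)
    assume "\<not> \<beta> \<le> 1"
    then have b: "0 < \<beta> - 1" by simp
    \<comment> \<open>The value of \<open>x powr (\<beta> - 1)\<close>, chosen so small that the estimate contradicts \<open>\<mu> > 0\<close>.\<close>
    define y where "y = min (1 / 2) (\<mu> / (2 * (C + 1)))"
    have y: "0 < y" "y < 1" "C * y \<le> \<mu> / 2"
    proof -
      show "0 < y" "y < 1" using \<mu> C by (auto simp: y_def)
      have "C * y \<le> (C + 1) * (\<mu> / (2 * (C + 1)))"
        using C \<mu> by (intro mult_mono) (auto simp: y_def)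
      moreover have "C + 1 \<noteq> 0" using C(1) by linarith
      then have "(C + 1) * (\<mu> / (2 * (C + 1))) = \<mu> / 2" by (simp add: divide_simps)
      ultimately show "C * y \<le> \<mu> / 2" by (simp only:)
    qed
    define x where "x = y powr (1 / (\<beta> - 1))"
    have x: "0 < x" "x < 1" using y b powr_less_mono2[of "1 / (\<beta> - 1)" y 1] by (auto simp: x_def)
    have "\<mu> = (\<integral>r. 1 \<partial>\<nu>)" by (simp add: \<mu>_def)
    also have "\<dots> \<le> (\<integral>r. 1 / (1 - r * (1 - x)\<^sup>2) \<partial>\<nu>)"
      using integrable_shimorin_weight[OF x] by (intro integral_mono) auto
    also have "\<dots> \<le> C * x powr (\<beta> - 1)" by (rule C(2)[OF x])
    also have "\<dots> = C * y" using y b by (simp add: x_def powr_powr)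
    finally show False using y \<mu> by simp
  qed
  \<comment> \<open>The constant is enlarged by \<open>\<mu>\<close> to cover \<open>x = 1\<close>.\<close>
  have level: "measure \<nu> {r \<in> space \<nu>. 1 - r \<le> x} \<le> (3 * C + \<mu>) * x powr \<beta>" if x: "0 < x" "x \<le> 1" for x
  proof (cases "x = 1")
    case True
    have "measure \<nu> {r \<in> space \<nu>. 1 - r \<le> x} \<le> \<mu>" unfolding \<mu>_def by (rule bounded_measure)
    then show ?thesis using True C by simp
  next
    case False
    with x have x1: "0 < x" "x < 1" by auto
    have "1 / (3 * x) * measure \<nu> {r \<in> space \<nu>. 1 - r \<le> x}
        = (\<integral>r. 1 / (3 * x) * indicator {r \<in> space \<nu>. 1 - r \<le> x} r \<partial>\<nu>)"
      by simp
    also have "\<dots> \<le> (\<integral>r. 1 / (1 - r * (1 - x)\<^sup>2) \<partial>\<nu>)"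
    proof (rule integral_mono[OF _ integrable_shimorin_weight(1)[OF x1]])
      show "integrable \<nu> (\<lambda>r. 1 / (3 * x) * indicator {r \<in> space \<nu>. 1 - r \<le> x} r)"
        by (intro integrable_mult_right integrable_const_bound[where B = 1]) (auto simp: indicator_def)
      show "1 / (3 * x) * indicator {r \<in> space \<nu>. 1 - r \<le> x} r \<le> 1 / (1 - r * (1 - x)\<^sup>2)"
        if "r \<in> space \<nu>" for r
      proof (cases "1 - r \<le> x")
        case True
        then show ?thesis
          using integrable_shimorin_weight(3)[OF x1 that True] that by simp
      next
        case False
        then show ?thesis
          using order_trans[OF zero_le_one integrable_shimorin_weight(2)[OF x1 that]]
          by (simp only: indicator_simps mem_Collect_eq simp_thms mult_zero_right)
      qed
    qed
    also have "\<dots> \<le> C * x powr (\<beta> - 1)" by (rule C(2)[OF x1])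
    finally have "3 * x * (1 / (3 * x) * measure \<nu> {r \<in> space \<nu>. 1 - r \<le> x})
        \<le> 3 * x * (C * x powr (\<beta> - 1))"
      using x by (intro mult_left_mono) auto
    then have "measure \<nu> {r \<in> space \<nu>. 1 - r \<le> x} \<le> 3 * C * (x powr 1 * x powr (\<beta> - 1))"
      using x by (simp add: mult_ac)
    also have "x powr 1 * x powr (\<beta> - 1) = x powr \<beta>" by (simp only: powr_add[symmetric]) simp
    also have "3 * C * x powr \<beta> \<le> (3 * C + \<mu>) * x powr \<beta>"
      using \<mu> by (intro mult_right_mono) auto
    finally show ?thesis .
  qed
  have le_c: "t \<le> 2 - 2 / c" if t: "0 < t" "t < \<beta>" for t
  proof -
    \<comment> \<open>The index at which the weight is \<open>1 / (1 - r\<^sup>2) powr t\<close>.\<close>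
    define c1 where "c1 = 2 / (2 - t)"
    have "t < 1" using t \<beta>1 by simp
    then have c1: "1 < c1" "c1 < 2" "2 - 2 / c1 = t" using t by (auto simp: c1_def field_simps)
    have "(\<integral>\<^sup>+ r. critical_weight (ereal c1) r \<partial>\<nu>) \<le> (\<integral>\<^sup>+ r. 1 / ennreal ((1 - r) powr t) \<partial>\<nu>)"
    proof (rule nn_integral_mono)
      fix r assume "r \<in> space \<nu>"
      then have r: "0 \<le> r" "r \<le> 1" by (auto simp: space_nu)
      then have "r\<^sup>2 \<le> r" by (simp add: power2_eq_square mult_left_le)
      then have "(1 - r) powr t \<le> (1 - r\<^sup>2) powr t" using r t by (intro powr_mono2) auto
      then show "critical_weight (ereal c1) r \<le> 1 / ennreal ((1 - r) powr t)"
        unfolding critical_weight_eq[OF c1(1)] c1(3)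
      proof (cases "r = 1")
        case False
        with r have "0 < (1 - r) powr t" by simp
        moreover from this \<open>(1 - r) powr t \<le> _\<close> have "0 < (1 - r\<^sup>2) powr t" by linarith
        ultimately have "1 / (1 - r\<^sup>2) powr t \<le> 1 / (1 - r) powr t"
          by (intro divide_left_mono[OF \<open>(1 - r) powr t \<le> _\<close> zero_le_one] mult_pos_pos)
        then show "1 / ennreal ((1 - r\<^sup>2) powr t) \<le> 1 / ennreal ((1 - r) powr t)"
          using \<open>0 < (1 - r) powr t\<close> \<open>0 < (1 - r\<^sup>2) powr t\<close>
          by (subst (1 2) ennreal_1[symmetric], subst (1 2) divide_ennreal) (auto intro: ennreal_leI)
      qed simp
    qed
    also have "\<dots> < \<infinity>"
    proof (rule order.strict_trans1[OF nn_integral_inverse_powr_le])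
      show "finite_measure \<nu>" by (rule finite_measure_axioms)
      show "measure \<nu> {r \<in> space \<nu>. 1 - r \<le> x} \<le> (3 * C + \<mu>) * x powr \<beta>" if "0 < x" "x \<le> 1" for x
        by (rule level[OF that])
    qed (use t C \<mu> in \<open>auto simp: space_nu\<close>)
    finally have "c1 \<le> c" using c1 by (intro critical_index_upper[OF c]) auto
    then have "2 / c \<le> 2 / c1" using c1 by (intro divide_left_mono) auto
    then show ?thesis using c1(3) by simp
  qed
  have "\<beta> \<le> 2 - 2 / c"
  proof (rule ccontr)
    assume neg: "\<not> \<beta> \<le> 2 - 2 / c"
    have "0 \<le> 2 - 2 / c" using c12 by (simp add: field_simps)
    with neg show False using le_c[of "((2 - 2 / c) + \<beta>) / 2"] by (simp add: field_simps)
  qed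
  then show ?thesis by (simp add: \<beta>_def)
qed

lemma bounded_shimorin_op_imp:
  assumes c: "critical_index \<nu> = ereal c" "1 \<le> c" and nz: "emeasure \<nu> (space \<nu>) \<noteq> 0"
    and pq: "1 \<le> p" "1 \<le> q" and uv: "1 / p = ereal u" "1 / q = ereal v"
    and bdd: "bounded_Lp_Lq p q disk_area (shimorin_op \<nu>)"
  shows "u + 1 / c - 1 \<le> v"
proof (rule ccontr)
  assume less: "\<not> u + 1 / c - 1 \<le> v"
  have "1 / c \<le> 1" using c by simp
  obtain u' where "1 / p = ereal u'" "0 \<le> u'" "u' \<le> 1" using ereal_reciprocal_real[OF pq(1)] .
  with uv have u: "0 \<le> u" "u \<le> 1" by auto
  obtain v' where "1 / q = ereal v'" "0 \<le> v'" "v' \<le> 1" using ereal_reciprocal_real[OF pq(2)] .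
  with uv have v: "0 \<le> v" "v \<le> 1" by auto
  have "0 < u" using less v \<open>1 / c \<le> 1\<close> by linarith
  then have p: "p = ereal (1 / u)" "1 \<le> 1 / u" using ereal_reciprocal_eqD[OF pq(1) uv(1)] u by auto
  \<comment> \<open>A target exponent \<open>q = \<infinity>\<close> is lowered to a large finite one.\<close>
  obtain v1 where v1: "0 < v1" "v \<le> v1" "v1 \<le> 1" "v1 < u + 1 / c - 1"
  proof (cases "v = 0")
    case True
    then show ?thesis
      using less u \<open>1 / c \<le> 1\<close> by (intro that[of "(u + 1 / c - 1) / 2"]) auto
  next
    case False
    then show ?thesis using less v by (intro that[of v]) auto
  qed
  have "ereal (1 / v1) \<le> q"
    using ereal_reciprocal_eqD[OF pq(2) uv(2)] v v1 by (auto simp: field_simps)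
  then have "bounded_Lp_Lq (ereal (1 / u)) (ereal (1 / v1)) disk_area (shimorin_op \<nu>)"
    using v1 p by (intro bounded_Lp_Lq_mono[OF prob_space_disk_area bdd pq(1)]) auto
  then have "1 / (1 / u) + 1 / c - 1 \<le> 1 / (1 / v1)"
    using v1 p by (intro critical_index_ge_of_bounded[OF c(1) nz]) auto
  then show False using v1 by simp
qed

end

section \<open>The boundedness theorem\<close>

theorem theorem1p1:
  fixes \<nu> :: "real measure" and p q :: ereal
  assumes "finite_measure \<nu>"
    and "sets \<nu> = sets (restrict_space borel {0..1})"
    and "emeasure \<nu> (space \<nu>) \<noteq> 0"
    and "1 \<le> p" and "1 \<le> q"
    and "(1 / p, 1 / q) \<notin> critical_segment \<nu>"
  shows "bounded_Lp_Lq p q disk_area (shimorin_op \<nu>) \<longleftrightarrow>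
    (p = 1 \<and> 1 \<le> q \<and> q < critical_index \<nu>) \<or>
    (1 < p \<and> p < dual_exponent (critical_index \<nu>) \<and>
       1 / q > 1 / p + 1 / critical_index \<nu> - 1) \<or>
    (p = dual_exponent (critical_index \<nu>) \<and> 1 \<le> q \<and> q < \<infinity>) \<or>
    (p > dual_exponent (critical_index \<nu>) \<and> 1 \<le> q \<and> q \<le> \<infinity>)"
proof -
  interpret shimorin \<nu>
    using assms(1,2) by (intro shimorin.intro shimorin_axioms.intro)
  obtain c where c: "critical_index \<nu> = ereal c" "1 \<le> c" "c \<le> 2"
    by (rule critical_index_real)
  obtain u where u: "1 / p = ereal u" using ereal_reciprocal_real[OF assms(4)] by blast
  obtain v where v: "1 / q = ereal v" using ereal_reciprocal_real[OF assms(5)] by blast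
  have iff: "?thesis \<longleftrightarrow> (bounded_Lp_Lq p q disk_area (shimorin_op \<nu>) \<longleftrightarrow> u + 1 / c - 1 < v)"
    unfolding c(1) exponent_conditions_iff[OF assms(4,5) c(2,3) u v] ..
  \<comment> \<open>Points of the critical line beyond the excluded segment would have \<open>p > c'\<close>, hence \<open>v < 0\<close>.\<close>
  have ne: "v \<noteq> u + 1 / c - 1"
  proof
    assume eq: "v = u + 1 / c - 1"
    have c1: "1 \<le> ereal c" using c by (simp add: one_ereal_def)
    have ck: "1 / ereal c = ereal (1 / c)"
      using c by (simp add: divide_ereal_def one_ereal_def field_simps)
    have "1 / q = 1 / p + 1 / ereal c - 1" unfolding u v ck eq by (simp add: one_ereal_def)
    moreover have "p \<le> dual_exponent (ereal c)"
    proof (rule ccontr)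
      assume "\<not> p \<le> dual_exponent (ereal c)"
      then have "u + 1 / c - 1 < v"
        using exponent_conditions_iff[OF assms(4,5) c(2,3) u v] assms(5) by auto
      with eq show False by simp
    qed
    ultimately have "(1 / p, 1 / q) \<in> critical_segment \<nu>"
      unfolding critical_segment_def c(1) using assms(4,5) by blast
    with assms(6) show False ..
  qed
  show ?thesis
    unfolding iff
  proof
    assume "bounded_Lp_Lq p q disk_area (shimorin_op \<nu>)"
    then have "u + 1 / c - 1 \<le> v"
      by (rule bounded_shimorin_op_imp[OF c(1,2) assms(3-5) u v])
    with ne show "u + 1 / c - 1 < v" by simp
  next
    assume "u + 1 / c - 1 < v"
    then show "bounded_Lp_Lq p q disk_area (shimorin_op \<nu>)"
      by (rule bounded_shimorin_op[OF c(1,2) assms(4,5) u v])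
  qed
qed

end
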